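(* Let $q\in(0,1)$ be fixed. For an integer $n\ge 2$, let $p(n)$ denote the smallest prime divisor of $n$, and let $P_q(n)$ denote the probability that the $n\times n$ circulant matrix $\mathrm{circ}(c_0,c_1,\dots,c_{n-1})$ is singular, where $c_0,\dots,c_{n-1}$ are independent random variables with $\mathbb{P}[c_j=1]=q$ and $\mathbb{P}[c_j=0]=1-q$. Then $$P_q(n)\sim \sum_{k=0}^{n/p(n)} \phi_q\bigl(k,n/p(n)\bigr)^{p(n)}\qquad\text{as } n\to\infty,$$ where $\phi_q(k,N)=\binom{N}{k}q^k(1-q)^{N-k}$.
   Context: The circulant matrix $\mathrm{circ}(x_0,\dots,x_{n-1})$ is the $n\times n$ matrix whose first row is $(x_0,x_1,\dots,x_{n-1})$ and each subsequent row is the cyclic right shift of the previous one, i.e. its $(i,j)$ entry is $x_{(j-i)\bmod n}$. For positive functions $f,g$ on the integers, $f\sim g$ means $f(n)/g(n)\to 1$. *)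

theory Defs
  imports
    "Jordan_Normal_Form.Matrix"
    "HOL-Probability.Product_PMF"
    "HOL-Library.Landau_Symbols"
    "HOL-Computational_Algebra.Primes"
begin

text \<open>For \<open>i, j < n\<close>, the natural number \<open>(j + n - i) mod n\<close> is the residue of the integer
  \<open>j - i\<close> modulo \<open>n\<close>; adding \<open>n\<close> first avoids truncated subtraction.\<close>

definition circulant_mat :: "nat \<Rightarrow> (nat \<Rightarrow> 'a) \<Rightarrow> 'a mat" where
  "circulant_mat n x = Matrix.mat n n (\<lambda>(i, j). x ((j + n - i) mod n))"

definition smallest_prime_divisor :: "nat \<Rightarrow> nat" where
  "smallest_prime_divisor n = (LEAST p. prime p \<and> p dvd n)"

text \<open>The outcomes \<open>\<omega> 0, \<dots>, \<omega> (n - 1)\<close> are independent and \<open>True\<close> with probability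
  \<open>q\<close>; the matrix entries are \<open>c\<^sub>j = of_bool (\<omega> j)\<close>. Indices outside \<open>{..<n}\<close> carry the
  dummy value \<open>False\<close> and do not occur in the matrix. The definition is meaningful for
  \<open>0 \<le> q \<le> 1\<close>.\<close>

definition prob_singular_circulant :: "real \<Rightarrow> nat \<Rightarrow> real" where
  "prob_singular_circulant q n =
     measure_pmf.prob (Pi_pmf {..<n} False (\<lambda>_. bernoulli_pmf q))
       {\<omega>. \<not> invertible_mat (circulant_mat n (\<lambda>j. of_bool (\<omega> j) :: real))}"

definition binomial_mass :: "real \<Rightarrow> nat \<Rightarrow> nat \<Rightarrow> real" where
  "binomial_mass q k N = real (N choose k) * q ^ k * (1 - q) ^ (N - k)"

end

theory Submission
  imports
    Defs
    "Jordan_Normal_Form.Char_Poly"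
    "HOL-Number_Theory.Number_Theory"
    "HOL-Real_Asymp.Real_Asymp"
begin

text \<open>
  Let \<open>C(z) = \<Sum> c\<^sub>j z\<^sup>j\<close>. The matrix is singular iff \<open>C\<close> vanishes at some \<open>n\<close>-th root of unity,
  hence, by Galois conjugation, iff \<open>C(\<zeta>\<^sub>d) = 0\<close> for some \<open>d\<close> dividing \<open>n\<close>, where
  \<open>\<zeta>\<^sub>d = exp(2\<pi>i/d)\<close>. Modulo \<open>z\<^sup>d - 1\<close> the coefficients of \<open>C\<close> become \<open>d\<close> independent binomial
  variables with parameters \<open>n/d\<close> and \<open>q\<close>. For \<open>d = p = p(n)\<close> the value at \<open>\<zeta>\<^sub>p\<close> is zero iff these are all
  equal, which has probability \<open>S = \<Sum> \<phi>(k, n/p)\<^sup>p\<close>; the case \<open>d = 1\<close> is contained in it.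
  For every other \<open>d\<close> the first \<open>f\<close> of the variables, \<open>f\<close> the totient of \<open>d\<close>, are determined by the
  remaining ones, so the probability is at most \<open>m(n/d)\<^sup>f\<close>, with \<open>m(N)\<close> the largest binomial
  probability.

  Since \<open>f \<ge> p\<close>, with \<open>f > p\<close> for \<open>p > 2\<close>, and \<open>S \<ge> m(n/p)\<^sup>p\<close>, the term of \<open>d\<close> is at most
  \<open>m(n/d)\<^bsup>f-p\<^esup> (m(n/d)/m(n/p))\<^sup>p S\<close>. Here \<open>m(N) = O(N\<^bsup>-1/2\<^esup>)\<close>, and
  \<open>m(M) \<le> (N/M)\<^bsup>O(1)\<^esup> m(N)\<close> for \<open>M \<le> N\<close>, so the second factor is at most \<open>e\<^bsup>O(f-p+1)\<^esup>\<close>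
  because \<open>p ln(d/p) = O(f-p+1)\<close>. Only boundedly many \<open>d\<close> have small \<open>f - p\<close>, and for \<open>p = 2\<close> one gains
  \<open>n\<^bsup>-1/2\<^esup>\<close> from the number of \<open>k\<close> with \<open>\<phi>(k, n/2) \<ge> m(n/2)/2\<close>. Divisors larger than
  \<open>n\<^bsup>3/4\<^esup>\<close> are treated separately, using that \<open>m\<close> is bounded away from 1.
\<close>

subsection \<open>Conjugate roots of unity\<close>

lemma prime_dvd_power_add:
  fixes x y :: "'a :: comm_ring_1"
  assumes "prime p"
  shows "of_nat p dvd (x + y) ^ p - (x ^ p + y ^ p)"
proof -
  have p: "p > 0" using assms prime_gt_0_nat by blast
  have "(x + y) ^ p = (\<Sum>k\<le>p. of_nat (p choose k) * x ^ k * y ^ (p - k))"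
    by (rule binomial_ring)
  also have "{..p} = insert 0 (insert p {1..<p})" using p by auto
  also have "(\<Sum>k\<in>insert 0 (insert p {1..<p}). of_nat (p choose k) * x ^ k * y ^ (p - k)) =
     x ^ p + y ^ p + (\<Sum>k\<in>{1..<p}. of_nat (p choose k) * x ^ k * y ^ (p - k))"
    using p by (simp add: add_ac)
  finally have "(x + y) ^ p - (x ^ p + y ^ p) =
      (\<Sum>k\<in>{1..<p}. of_nat (p choose k) * x ^ k * y ^ (p - k))" by simp
  moreover have "of_nat p dvd (\<Sum>k\<in>{1..<p}. of_nat (p choose k) * x ^ k * y ^ (p - k))"
  proof (rule dvd_sum)
    fix k assume "k \<in> {1..<p}"
    then have "p dvd (p choose k)" using assms p by (intro dvd_choose_prime) auto
    then have "of_nat p dvd (of_nat (p choose k) :: 'a)"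
      by (metis dvd_def of_nat_mult)
    then show "of_nat p dvd of_nat (p choose k) * x ^ k * y ^ (p - k)" by simp
  qed
  ultimately show ?thesis by simp
qed

lemma prime_dvd_power_self_diff:
  fixes a :: int
  assumes "prime p"
  shows "int p dvd a ^ p - a"
proof -
  have nat_case: "int p dvd int n ^ p - int n" for n
  proof (induction n)
    case 0 then show ?case using assms prime_gt_0_nat by (simp add: zero_power)
  next
    case (Suc n)
    have "int p dvd (int n + 1) ^ p - (int n ^ p + 1 ^ p)"
      using prime_dvd_power_add[OF assms, of "int n" 1] by simp
    from dvd_add[OF this Suc] show ?case by (simp add: algebra_simps)
  qed
  have p: "int p > 0" using assms prime_gt_0_nat by simp
  \<comment> \<open>The induction covers natural numbers; an arbitrary \<open>a\<close> is replaced
    by its nonnegative residue.\<close>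
  have "[a = int (nat (a mod int p))] (mod int p)"
    using p by (simp add: cong_def)
  then have "[a ^ p - a = int (nat (a mod int p)) ^ p - int (nat (a mod int p))] (mod int p)"
    by (intro cong_diff cong_pow)
  with nat_case show ?thesis using cong_dvd_iff by blast
qed

text \<open>Frobenius on integer polynomials: the \<open>p\<close>-th power is additive modulo
  \<open>p\<close> and, by Fermat's little theorem, fixes constants, so induction over the
  coefficients suffices.\<close>

lemma prime_dvd_pcompose_power_diff:
  fixes f :: "int poly"
  assumes "prime p"
  shows "of_nat p dvd f \<circ>\<^sub>p ([:0, 1:] ^ p) - f ^ p"
proof (induction f)
  case 0
  then show ?case using assms prime_gt_0_nat by (simp add: zero_power)
next
  case (pCons a g)
  let ?X = "[:0, 1:] :: int poly"
  have 1: "pCons a g = [:a:] + ?X * g" by simp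
  have 2: "pCons a g \<circ>\<^sub>p (?X ^ p) = [:a:] + ?X ^ p * (g \<circ>\<^sub>p (?X ^ p))"
    by (simp add: pcompose_pCons)
  have "[:a:] ^ p - [:a:] = [:a ^ p - a:]" by (simp add: poly_const_pow)
  moreover have "of_nat p dvd [:a ^ p - a:]"
  proof -
    from prime_dvd_power_self_diff[OF assms, of a] obtain k where "a ^ p - a = int p * k" by (auto elim: dvdE)
    then have "[:a ^ p - a:] = of_nat p * [:k:]" by (simp add: of_nat_poly)
    then show ?thesis by (metis dvd_triv_left)
  qed
  ultimately have A: "of_nat p dvd [:a:] ^ p - [:a:]" by simp
  have B: "of_nat p dvd ?X ^ p * (g \<circ>\<^sub>p (?X ^ p) - g ^ p)" using pCons by simp
  have C: "of_nat p dvd ([:a:] + ?X * g) ^ p - ([:a:] ^ p + (?X * g) ^ p)"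
    by (rule prime_dvd_power_add[OF assms])
  \<comment> \<open>With the indeterminate hidden behind \<open>Y\<close>, what follows is a pure
    ring identity combining the errors of \<open>A\<close>, \<open>B\<close> and
    \<open>C\<close>.\<close>
  define Y where "Y = ?X"
  have "pCons a g \<circ>\<^sub>p (Y ^ p) - pCons a g ^ p =
     Y ^ p * (g \<circ>\<^sub>p (Y ^ p) - g ^ p) - ([:a:] ^ p - [:a:]) - (([:a:] + Y * g) ^ p - ([:a:] ^ p + (Y * g) ^ p))"
    unfolding 2[folded Y_def] unfolding 1[folded Y_def] power_mult_distrib
    by (simp only: algebra_simps)
  also have "of_nat p dvd \<dots>" using A B C unfolding Y_def by (blast intro: dvd_diff)
  finally show ?case unfolding Y_def .
qed

section \<open>Integer polynomials at complex points and their conjugate roots\<close>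

abbreviation int_poly_at :: "int poly \<Rightarrow> complex \<Rightarrow> complex" where
  "int_poly_at g z \<equiv> poly (map_poly of_int g) z"

lemma int_poly_at_of_nat [simp]: "poly (map_poly of_int (of_nat n)) (z :: complex) = of_nat n"
  by (induction n) (simp_all add: of_int_poly_hom.hom_add)

text \<open>Take a nonzero polynomial of least degree with root \<open>z\<close> and make it
  primitive. Pseudo-division shows that it divides some \<open>smult a h\<close>; by Gauss's lemma
  \<open>a\<close> divides the content of the quotient and cancels, so divisibility holds over the
  integers and not only over the rationals.\<close>

lemma primitive_minimal_int_poly:
  assumes "g \<noteq> 0" "int_poly_at g z = 0"
  obtains f where "f \<noteq> 0" "content f = 1" "int_poly_at f z = 0"
    "\<And>h. int_poly_at h z = 0 \<Longrightarrow> f dvd h"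
proof -
  define Q where "Q = (\<lambda>f :: int poly. f \<noteq> 0 \<and> int_poly_at f z = 0)"
  have "Q g" using assms by (simp add: Q_def)
  then obtain f0 where f0: "Q f0" "\<And>h. Q h \<Longrightarrow> degree f0 \<le> degree h"
    using arg_min_nat_lemma[of Q g degree] by blast
  define f where "f = primitive_part f0"
  have f0_eq: "f0 = smult (content f0) f" by (simp add: f_def)
  have "f \<noteq> 0" using f0 unfolding f_def Q_def by simp
  have cont: "content f = 1" using f0 unfolding f_def Q_def by simp
  have "content f0 \<noteq> 0" using f0 by (simp add: Q_def)
  have root: "int_poly_at f z = 0"
  proof -
    have "int_poly_at (smult (content f0) f) z = 0" using f0(1) f0_eq unfolding Q_def by simp
    then show ?thesis using \<open>content f0 \<noteq> 0\<close> by (simp add: of_int_hom.map_poly_hom_smult)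
  qed
  have deg: "degree f = degree f0" by (simp add: f_def)
  have "f dvd h" if h: "int_poly_at h z = 0" for h
  proof -
    obtain a q where aq: "a \<noteq> 0" "smult a h = f * q + pseudo_mod h f"
      using pseudo_mod(1)[OF \<open>f \<noteq> 0\<close>, of h] by auto
    have "int_poly_at (smult a h) z = int_poly_at (pseudo_mod h f) z"
      unfolding aq(2) by (simp add: root of_int_poly_hom.hom_add of_int_poly_hom.hom_mult)
    then have "int_poly_at (pseudo_mod h f) z = 0" using h by (simp add: of_int_hom.map_poly_hom_smult)
    then have "pseudo_mod h f = 0"
      using pseudo_mod(2)[OF \<open>f \<noteq> 0\<close>, of h] f0(2)[of "pseudo_mod h f"] deg
      unfolding Q_def by fastforce
    then have eq: "smult a h = f * q" using aq by simp
    then have "content (smult a h) = content q" by (simp add: content_mult cont)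
    then have "content q = normalize a * content h" by (simp)
    then have "a dvd content q" by simp
    then have "[:a:] dvd q" using const_poly_dvd_iff_dvd_content by blast
    then obtain q' where "q = smult a q'" by (auto elim!: dvdE)
    with eq have "smult a h = smult a (f * q')" by simp
    then have "smult a (h - f * q') = 0" by (simp add: smult_diff_right)
    then have "h = f * q'" using aq(1) by simp
    then show ?thesis by simp
  qed
  with \<open>f \<noteq> 0\<close> cont root that show thesis by blast
qed

text \<open>
  Schur's argument. Let \<open>f\<close> be the minimal polynomial of \<open>z\<close> and \<open>X\<^sup>d - 1 = f u\<close>. If
  \<open>f(z\<^sup>p) \<noteq> 0\<close>, then \<open>u(z\<^sup>p) = 0\<close>, and the derivative of \<open>f u\<close> at \<open>z\<^sup>p\<close> shows that \<open>d\<close> is a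
  multiple of \<open>f(z\<^sup>p)\<close>, hence of \<open>p\<close>, in the ring generated by \<open>z\<close>, as \<open>f(X\<^sup>p)\<close> and \<open>f(X)\<^sup>p\<close> agree
  modulo \<open>p\<close>. Since \<open>f\<close> is monic up to sign, this ring is free over the integers with 1 in a basis,
  so \<open>p\<close> divides \<open>d\<close>.
\<close>

lemma int_poly_root_unity_power_prime:
  assumes z: "z ^ d = 1" and d: "d > 0" and p: "prime p" "\<not> p dvd d"
    and g: "int_poly_at g z = 0"
  shows "int_poly_at g (z ^ p) = 0"
proof -
  let ?X = "[:0, 1:] :: int poly"
  have root: "int_poly_at (?X ^ d - 1) w = w ^ d - 1" for w
    by (simp add: of_int_poly_hom.hom_minus of_int_poly_hom.hom_power)
  have dX: "degree (?X ^ d) = d" by (simp add: degree_power_eq)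
  have "?X ^ d - 1 \<noteq> 0" using d dX by (metis degree_1 eq_iff_diff_eq_0 less_irrefl_nat)
  from primitive_minimal_int_poly[OF this, of z] root z
  obtain f where f: "f \<noteq> 0" "content f = 1" "int_poly_at f z = 0" and
    min: "\<And>h. int_poly_at h z = 0 \<Longrightarrow> f dvd h" by auto
  obtain u where u: "?X ^ d - 1 = f * u" using min[of "?X ^ d - 1"] root[of z] z by (auto elim: dvdE)
  obtain h where h: "f \<circ>\<^sub>p (?X ^ p) - f ^ p = of_nat p * h"
    using prime_dvd_pcompose_power_diff[OF p(1)] by (blast elim: dvdE)
  have fz: "int_poly_at f (z ^ p) = of_nat p * int_poly_at h z"
  proof -
    have "int_poly_at f (z ^ p) = int_poly_at (f \<circ>\<^sub>p (?X ^ p)) z"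
      by (simp add: of_int_hom.map_poly_pcompose poly_pcompose of_int_poly_hom.hom_power)
    also have "f \<circ>\<^sub>p (?X ^ p) = f ^ p + of_nat p * h" using h by (simp add: algebra_simps)
    also have "int_poly_at \<dots> z = of_nat p * int_poly_at h z"
      using f(3) prime_gt_0_nat[OF p(1)]
      by (simp add: of_int_poly_hom.hom_add of_int_poly_hom.hom_mult of_int_poly_hom.hom_power zero_power)
    finally show ?thesis .
  qed
  have "int_poly_at f (z ^ p) = 0"
  proof (rule ccontr)
    assume nz: "int_poly_at f (z ^ p) \<noteq> 0"
    have zp: "(z ^ p) ^ d = 1" using z by (metis mult.commute power_mult power_one)
    have "int_poly_at f (z ^ p) * int_poly_at u (z ^ p) = 0"
      using root[of "z ^ p"] zp unfolding u by (simp add: of_int_poly_hom.hom_mult)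
    with nz have u0: "int_poly_at u (z ^ p) = 0" by simp
    have "pderiv (?X ^ d - 1) = of_nat d * ?X ^ (d - 1)"
      by (simp add: pderiv_diff pderiv_power pderiv_pCons of_nat_poly)
    then have "of_nat d * ?X ^ (d - 1) = pderiv f * u + f * pderiv u"
      unfolding u by (simp add: pderiv_mult algebra_simps)
    then have "int_poly_at (of_nat d * ?X ^ (d - 1)) (z ^ p) =
        int_poly_at (pderiv f * u + f * pderiv u) (z ^ p)" by simp
    then have "of_nat d * (z ^ p) ^ (d - 1) = int_poly_at f (z ^ p) * int_poly_at (pderiv u) (z ^ p)"
      using u0 by (simp add: of_int_poly_hom.hom_add of_int_poly_hom.hom_mult of_int_poly_hom.hom_power)
    then have "of_nat d * ((z ^ p) ^ (d - 1) * z ^ p) =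
        of_nat p * (int_poly_at h z * int_poly_at (pderiv u) (z ^ p) * z ^ p)"
      unfolding fz by simp
    also have "(z ^ p) ^ (d - 1) * z ^ p = 1" using zp d by (metis power_minus_mult)
    finally have dz: "of_nat d = of_nat p * (int_poly_at h z * int_poly_at (pderiv u) (z ^ p) * z ^ p)"
      by simp
    define \<delta> where "\<delta> = h * (pderiv u \<circ>\<^sub>p (?X ^ p)) * ?X ^ p"
    have "int_poly_at (of_nat p * \<delta> - of_nat d) z = 0"
      using dz unfolding \<delta>_def
      by (simp add: of_int_poly_hom.hom_minus of_int_poly_hom.hom_mult of_int_poly_hom.hom_power
          of_int_hom.map_poly_pcompose poly_pcompose)
    then have dvd: "f dvd of_nat p * \<delta> - of_nat d" by (rule min)
    \<comment> \<open>Pseudo-division scales \<open>\<delta>\<close> by a power \<open>a\<close> of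
      the leading coefficient of \<open>f\<close>. That coefficient divides the one of
      \<open>X^d - 1\<close>, so \<open>a\<close> is a unit. The polynomial \<open>p r - a d\<close>
      is a multiple of \<open>f\<close> of smaller degree, hence zero, and its constant term shows
      that \<open>p\<close> divides \<open>a d\<close>.\<close>
    obtain q r where qr: "pseudo_divmod \<delta> f = (q, r)" by fastforce
    define a where "a = lead_coeff f ^ (Suc (degree \<delta>) - degree f)"
    have pd: "smult a \<delta> = f * q + r" "r = 0 \<or> degree r < degree f"
      using pseudo_divmod[OF f(1) qr] unfolding a_def by auto
    have "of_nat p * r - of_int a * of_nat d = of_int a * (of_nat p * \<delta> - of_nat d) - f * (of_nat p * q)"
    proof -
      have r: "r = of_int a * \<delta> - f * q" using pd(1) by (simp add: of_int_poly)
      show ?thesis by (subst r) (simp add: algebra_simps)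
    qed
    then have dvd': "f dvd of_nat p * r - of_int a * of_nat d" using dvd by simp
    have "degree f > 0"
    proof (rule ccontr)
      assume "\<not> degree f > 0"
      then obtain c where "f = [:c:]" by (auto elim: degree_eq_zeroE)
      with f show False by simp
    qed
    have "degree (of_nat p * r - of_int a * of_nat d) < degree f"
    proof (rule degree_diff_less)
      show "degree (of_nat p * r) < degree f"
        using pd(2) \<open>degree f > 0\<close> by (auto simp: of_nat_poly intro: le_less_trans[OF degree_smult_le])
      show "degree (of_int a * of_nat d :: int poly) < degree f"
        using \<open>degree f > 0\<close> by (simp add: of_nat_poly of_int_poly)
    qed
    with dvd' have "of_nat p * r - of_int a * of_nat d = 0"
      using dvd_imp_degree_le leD by blast
    then have "Polynomial.coeff (of_nat p * r) 0 = Polynomial.coeff (of_int a * of_nat d) 0" by simp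
    then have "int p * Polynomial.coeff r 0 = a * int d" by (simp add: of_nat_poly of_int_poly)
    then have "int p dvd a * int d" by (metis dvd_triv_left)
    moreover have "is_unit a"
    proof -
      have "lead_coeff (?X ^ d - 1) = 1"
      proof -
        have "degree (?X ^ d + (- 1)) = d" using d dX by (subst degree_add_eq_left) auto
        then show ?thesis using d dX lead_coeff_power[of ?X d] by simp
      qed
      then have "lead_coeff f * lead_coeff u = 1" unfolding u by (simp add: lead_coeff_mult)
      then have "is_unit (lead_coeff f)" by (metis dvd_triv_left)
      then show ?thesis unfolding a_def by (metis is_unit_power_iff)
    qed
    ultimately have "int p dvd int d" by (metis dvd_mult_unit_iff' )
    with p(2) show False by simp
  qed
  moreover have "f dvd g" using min g by blast
  ultimately show ?thesis by (auto elim!: dvdE simp: of_int_poly_hom.hom_mult)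
qed


text \<open>Peel the primes off \<open>k\<close> one at a time; each is coprime to \<open>d\<close>,
  hence does not divide it. The point \<open>z\<close> is generalised because the remaining factor
  acts on \<open>z ^ p\<close>. For \<open>k = 0\<close>, coprimality forces \<open>d = 1\<close>
  and \<open>z = 1\<close>.\<close>

lemma int_poly_root_unity_power_coprime:
  assumes "z ^ d = 1" "d > 0" "coprime k d" "int_poly_at g z = 0"
  shows "int_poly_at g (z ^ k) = 0"
proof (cases "k = 0")
  case True
  with assms show ?thesis by simp
next
  case False
  then show ?thesis using assms
  proof (induction k arbitrary: z rule: prime_divisors_induct)
    case (unit x)
    then show ?case by simp
  next
    case (factor p x)
    then have "coprime p d" "coprime x d" "x \<noteq> 0" by auto
    have "\<not> p dvd d" using factor.hyps \<open>coprime p d\<close>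
      by (metis coprime_absorb_left not_prime_unit)
    have "int_poly_at g (z ^ p) = 0"
      using int_poly_root_unity_power_prime[of z d p g] factor \<open>\<not> p dvd d\<close> by blast
    moreover have "(z ^ p) ^ d = 1" using factor.prems(2) by (metis mult.commute power_mult power_one)
    ultimately have "int_poly_at g ((z ^ p) ^ x) = 0"
      using factor.IH[of "z ^ p"] \<open>x \<noteq> 0\<close> \<open>coprime x d\<close> factor.prems by blast
    then show ?case by (simp add: power_mult)
  qed auto
qed

text \<open>Conjugation turns one root into \<open>totient d\<close> distinct ones, more than a
  nonzero polynomial of this degree can have.\<close>

lemma int_poly_at_cis_eq_0_imp_eq_0:
  assumes d: "d > 0" and g: "int_poly_at g (cis (2 * pi / real d)) = 0" and deg: "degree g < totient d"
  shows "g = 0"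
proof (rule ccontr)
  assume "g \<noteq> 0"
  let ?z = "cis (2 * pi / real d)"
  let ?g = "map_poly of_int g :: complex poly"
  have pow: "?z ^ k = cis (2 * pi * real k / real d)" for k
    using Complex.DeMoivre[of "2 * pi / real d" k] by (simp add: mult_ac)
  have "?z ^ d = 1" using d by (simp add: pow)
  have inj: "inj_on (\<lambda>k. ?z ^ k) (totatives d)"
  \<comment> \<open>The only totative of 1 is 1 itself, which is not below \<open>d\<close>; in all
    other cases the totatives lie in \<open>{..<d}\<close>.\<close>
  proof (cases "d = 1")
    case False
    have "inj_on (\<lambda>k. ?z ^ k) {..<d}"
      using Complex.bij_betw_roots_unity[OF d] unfolding bij_betw_def pow by blast
    then show ?thesis
      by (rule inj_on_subset) (use totatives_less False d in \<open>auto simp: totatives_def\<close>)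
  qed auto
  have "(\<lambda>k. ?z ^ k) ` totatives d \<subseteq> {x. poly ?g x = 0}"
    using int_poly_root_unity_power_coprime[OF \<open>?z ^ d = 1\<close> d _ g] by (auto simp: totatives_def)
  moreover have nz: "?g \<noteq> 0" using \<open>g \<noteq> 0\<close> by (simp add: map_poly_eq_0_iff)
  ultimately have "card ((\<lambda>k. ?z ^ k) ` totatives d) \<le> card {x. poly ?g x = 0}"
    using poly_roots_finite card_mono by blast
  also have "\<dots> \<le> degree ?g" using nz by (rule poly_roots_degree)
  also have "\<dots> = degree g" by simp
  finally show False using deg card_image[OF inj] by (simp add: totient_def)
qed

subsection \<open>Singularity of circulant matrices\<close>

lemma power_mod_root_unity:
  fixes w :: "'a :: monoid_mult"
  assumes "w ^ n = 1"
  shows "w ^ (k mod n) = w ^ k"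
  by (metis assms mod_mult_div_eq mult_1_right power_add power_mult power_one)

lemma power_cong_root_unity:
  fixes w :: "'a :: monoid_mult"
  assumes "w ^ n = 1" "[a = b] (mod n)"
  shows "w ^ a = w ^ b"
  by (metis assms cong_def power_mod_root_unity)

lemma sum_rotate_mod:
  fixes h :: "nat \<Rightarrow> 'a :: comm_monoid_add"
  assumes "k < n"
  shows "(\<Sum>i<n. h ((i + n - k) mod n)) = (\<Sum>l<n. h l)"
proof -
  have "((l + k) mod n + n - k) mod n = l" if "l < n" for l
  proof (cases "l + k < n")
    case False
    then have "(l + k) mod n = l + k - n" using assms that by (simp add: le_mod_geq)
    then show ?thesis using False that by simp
  qed (use that in auto)
  moreover have "((i + n - k) mod n + k) mod n = i" if "i < n" for i
    using assms that by (simp add: mod_add_left_eq)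
  ultimately show ?thesis
    by (intro sum.reindex_bij_witness[of _ "\<lambda>l. (l + k) mod n" "\<lambda>i. (i + n - k) mod n"])
       (use assms in auto)
qed

text \<open>For fixed \<open>j\<close>, sending \<open>i\<close> to \<open>j - i\<close> modulo
  \<open>n\<close> is an involution, so it is its own inverse in the reindexing.\<close>

lemma sum_reflect_mod:
  fixes h :: "nat \<Rightarrow> nat \<Rightarrow> 'a :: comm_monoid_add"
  assumes "j < n"
  shows "(\<Sum>i<n. h i ((j + n - i) mod n)) = (\<Sum>l<n. h ((j + n - l) mod n) l)"
proof -
  have inv: "(j + n - (j + n - i) mod n) mod n = i" if "i < n" for i
  proof (cases "i \<le> j")
    case True
    then have "(j + n - i) mod n = j - i" using assms by (simp add: mod_if)
    then show ?thesis using True assms that by (simp add: mod_if)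
  next
    case False
    then have "(j + n - i) mod n = j + n - i" using that by simp
    then show ?thesis using False assms that by simp
  qed
  show ?thesis
    by (rule sum.reindex_bij_witness[of _ "\<lambda>l. (j + n - l) mod n" "\<lambda>i. (j + n - i) mod n"])
       (use assms inv in auto)
qed

lemma cis_power_order: "d > 0 \<Longrightarrow> cis (2 * pi / real d) ^ d = 1"
  using Complex.DeMoivre[of "2 * pi / real d" d] by simp

lemma cis_power_neq_1:
  assumes "0 < t" "t < n"
  shows "cis (2 * pi / real n) ^ t \<noteq> 1"
proof
  assume "cis (2 * pi / real n) ^ t = 1"
  then have "cis (2 * pi * real t / real n) = cis (2 * pi * real 0 / real n)"
    using Complex.DeMoivre[of "2 * pi / real n" t] by (simp add: mult_ac)
  moreover have "inj_on (\<lambda>k. cis (2 * pi * real k / real n)) {..<n}"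
    using Complex.bij_betw_roots_unity[of n] assms by (auto dest: bij_betw_imp_inj_on)
  ultimately show False using assms by (auto dest: inj_onD[of _ _ t 0])
qed

lemma circulant_mat_carrier [simp]: "circulant_mat n c \<in> carrier_mat n n"
  by (simp add: circulant_mat_def)

text \<open>The vector of powers \<open>w ^ k\<close> is an eigenvector whose eigenvalue is the
  vanishing sum. Its entry at 0 is 1, so row 0 of \<open>B * ?A = 1\<close>, applied to it, would
  give \<open>1 = 0\<close>. The products are expanded by hand because the matrix is real and the
  vector complex.\<close>

lemma circulant_root_imp_singular:
  fixes c :: "nat \<Rightarrow> real" and w :: complex
  assumes n: "n > 0" and w: "w ^ n = 1" and root: "(\<Sum>j<n. of_real (c j) * w ^ j) = 0"
  shows "\<not> invertible_mat (circulant_mat n c)"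
proof
  let ?A = "circulant_mat n c"
  assume "invertible_mat ?A"
  then obtain B where B: "B * ?A = 1\<^sub>m (dim_row B)" "?A * B = 1\<^sub>m n"
    unfolding invertible_mat_def inverts_mat_def by (auto simp: circulant_mat_def)
  have dimB: "dim_row B = n" "dim_col B = n"
    using arg_cong[OF B(1), of dim_col] arg_cong[OF B(2), of dim_col] by (auto simp: circulant_mat_def)
  have row: "(\<Sum>k<n. of_real (c ((k + n - j) mod n)) * w ^ k) = 0" if j: "j < n" for j
  proof -
    have "(\<Sum>k<n. of_real (c ((k + n - j) mod n)) * w ^ k) =
        (\<Sum>k<n. w ^ j * (of_real (c ((k + n - j) mod n)) * w ^ ((k + n - j) mod n)))"
    proof (intro sum.cong refl)
      fix k assume "k \<in> {..<n}"
      have "w ^ k = w ^ (j + (k + n - j))" using j w by (simp add: power_add)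
      also have "\<dots> = w ^ j * w ^ ((k + n - j) mod n)"
        by (simp add: power_add power_mod_root_unity[OF w])
      finally show "of_real (c ((k + n - j) mod n)) * w ^ k =
          w ^ j * (of_real (c ((k + n - j) mod n)) * w ^ ((k + n - j) mod n))" by simp
    qed
    also have "\<dots> = w ^ j * (\<Sum>l<n. of_real (c l) * w ^ l)"
      unfolding sum_distrib_left[symmetric]
      using sum_rotate_mod[OF j, of "\<lambda>l. of_real (c l) * w ^ l"] by simp
    finally show ?thesis using root by simp
  qed
  have "(1 :: complex) = (\<Sum>k<n. of_real ((B * ?A) $$ (0, k)) * w ^ k)"
  proof -
    have "(\<Sum>k<n. of_real ((B * ?A) $$ (0, k)) * w ^ k) = (\<Sum>k<n. if k = 0 then 1 else 0)"
      unfolding B(1) dimB using n by (intro sum.cong) auto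
    then show ?thesis using n by simp
  qed
  also have "\<dots> = (\<Sum>k<n. \<Sum>j<n. of_real (B $$ (0, j)) * (of_real (c ((k + n - j) mod n)) * w ^ k))"
  proof (intro sum.cong refl)
    fix k assume k: "k \<in> {..<n}"
    have "(B * ?A) $$ (0, k) = (\<Sum>j<n. B $$ (0, j) * c ((k + n - j) mod n))"
      using k n dimB by (simp add: scalar_prod_def circulant_mat_def lessThan_atLeast0)
    then show "of_real ((B * ?A) $$ (0, k)) * w ^ k =
        (\<Sum>j<n. of_real (B $$ (0, j)) * (of_real (c ((k + n - j) mod n)) * w ^ k))"
      by (simp add: sum_distrib_right mult.assoc)
  qed
  also have "\<dots> = (\<Sum>j<n. of_real (B $$ (0, j)) * (\<Sum>k<n. of_real (c ((k + n - j) mod n)) * w ^ k))"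
    by (subst sum.swap) (simp add: sum_distrib_left)
  also have "\<dots> = 0" using row by simp
  finally show False by simp
qed

lemma sum_powers_root_unity:
  fixes w :: complex
  assumes "w ^ n = 1" "w \<noteq> 1"
  shows "(\<Sum>k<n. w ^ k) = 0"
  using assms by (simp add: sum_gp_strict)

text \<open>
  If no value \<open>C(w\<^sup>k)\<close> vanishes, the Fourier transform of a kernel vector is zero, so the vector is
  zero by Fourier inversion.
\<close>

lemma circulant_singular_imp_root:
  fixes c :: "nat \<Rightarrow> real"
  assumes n: "n > 0" and sing: "\<not> invertible_mat (circulant_mat n c)"
  obtains k where "k < n" "(\<Sum>j<n. of_real (c j) * (cis (2 * pi / real n) ^ k) ^ j) = 0"
proof -
  let ?A = "circulant_mat n c"
  define w where "w = cis (2 * pi / real n)"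
  have w: "w ^ n = 1" using n by (simp add: w_def cis_power_order)
  have w_ne: "w ^ t \<noteq> 1" if "0 < t" "t < n" for t
    unfolding w_def using that by (rule cis_power_neq_1)
  have "det ?A = 0"
  proof (rule ccontr)
    assume "det ?A \<noteq> 0"
    then obtain B where "B \<in> carrier_mat n n" "B * ?A = 1\<^sub>m n" "?A * B = 1\<^sub>m n"
      using det_non_zero_imp_unit[of ?A n undefined] by (auto simp: Units_def ring_mat_def)
    then have "invertible_mat ?A"
      unfolding invertible_mat_def inverts_mat_def square_mat.simps
      by (metis carrier_matD circulant_mat_carrier)
    with sing show False by simp
  qed
  then obtain v where v: "v \<in> carrier_vec n" "v \<noteq> 0\<^sub>v n" "?A *\<^sub>v v = 0\<^sub>v n"
    using det_0_iff_vec_prod_zero_field[of ?A n] by auto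
  have row: "(\<Sum>j<n. c ((j + n - i) mod n) * v $ j) = 0" if i: "i < n" for i
  proof -
    have "(?A *\<^sub>v v) $ i = (\<Sum>j<n. c ((j + n - i) mod n) * v $ j)"
      using i v(1) by (simp add: circulant_mat_def scalar_prod_def lessThan_atLeast0)
    then show ?thesis using v(3) i by simp
  qed
  define C where "C = (\<lambda>k. \<Sum>j<n. of_real (c j) * (w ^ k) ^ j)"
  \<comment> \<open>The exponent \<open>n - j\<close> stands for \<open>-j\<close>, as
    \<open>w ^ k\<close> is an \<open>n\<close>-th root of unity. With this sign the product
    \<open>C k * V k\<close> is the transform of the matrix-vector product.\<close>
  define V where "V = (\<lambda>k. \<Sum>j<n. of_real (v $ j) * (w ^ k) ^ (n - j))"
  have CV: "C k * V k = 0" for k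
  proof -
    define u where "u = w ^ k"
    have u: "u ^ n = 1" by (metis mult.commute power_mult power_one u_def w)
    have "0 = (\<Sum>i<n. u ^ (n - i) * of_real (\<Sum>j<n. c ((j + n - i) mod n) * v $ j))"
      using row by simp
    also have "\<dots> = (\<Sum>j<n. \<Sum>i<n. u ^ (n - i) * (of_real (c ((j + n - i) mod n)) * of_real (v $ j)))"
      by (subst sum.swap) (simp add: sum_distrib_left)
    also have "\<dots> = (\<Sum>j<n. of_real (v $ j) * u ^ (n - j) * C k)"
    proof (intro sum.cong refl)
      fix j assume "j \<in> {..<n}"
      then have j: "j < n" by simp
      have "(\<Sum>i<n. u ^ (n - i) * (of_real (c ((j + n - i) mod n)) * of_real (v $ j))) =
         (\<Sum>i<n. of_real (v $ j) * u ^ (n - j) *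
            (of_real (c ((j + n - i) mod n)) * u ^ ((j + n - i) mod n)))"
      proof (intro sum.cong refl)
        fix i assume i: "i \<in> {..<n}"
        have "n - j + (j + n - i) = n + (n - i)" using i j by auto
        then have "u ^ (n - i) = u ^ (n - j + (j + n - i))" using u by (simp add: power_add)
        also have "\<dots> = u ^ (n - j) * u ^ ((j + n - i) mod n)"
          by (simp add: power_add power_mod_root_unity[OF u])
        finally show "u ^ (n - i) * (of_real (c ((j + n - i) mod n)) * of_real (v $ j)) =
          of_real (v $ j) * u ^ (n - j) *
            (of_real (c ((j + n - i) mod n)) * u ^ ((j + n - i) mod n))" by simp
      qed
      also have "\<dots> = of_real (v $ j) * u ^ (n - j) * C k"
        unfolding sum_distrib_left[symmetric] C_def u_def[symmetric]
        by (subst sum_reflect_mod[OF j, of "\<lambda>i l. of_real (c l) * u ^ l"]) simp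
      finally show "(\<Sum>i<n. u ^ (n - i) * (of_real (c ((j + n - i) mod n)) * of_real (v $ j))) =
          of_real (v $ j) * u ^ (n - j) * C k" .
    qed
    also have "\<dots> = C k * V k"
      unfolding V_def u_def[symmetric] by (simp add: sum_distrib_right[symmetric])
    finally show ?thesis by simp
  qed
  have "\<exists>k<n. C k = 0"
  proof (rule ccontr)
    assume "\<not> (\<exists>k<n. C k = 0)"
    then have V0: "V k = 0" if "k < n" for k using CV[of k] that by auto
    have "v $ m = 0" if m: "m < n" for m
    proof -
      have "0 = (\<Sum>k<n. (w ^ k) ^ m * V k)" using V0 by simp
      also have "\<dots> = (\<Sum>j<n. of_real (v $ j) * (\<Sum>k<n. (w ^ (m + (n - j))) ^ k))"
      proof -
        have "(w ^ k) ^ m * (of_real (v $ j) * (w ^ k) ^ (n - j)) =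
            of_real (v $ j) * (w ^ (m + (n - j))) ^ k" for j k
          by (simp only: power_mult[symmetric] power_add[symmetric] distrib_left mult.commute[of _ k] mult.left_commute)
        then show ?thesis unfolding V_def sum_distrib_left by (subst sum.swap) (simp only:)
      qed
      also have "\<dots> = (\<Sum>j<n. if j = m then of_real (v $ m) * of_nat n else 0)"
      proof (intro sum.cong refl)
        fix j assume "j \<in> {..<n}"
        then have j: "j < n" by simp
        show "of_real (v $ j) * (\<Sum>k<n. (w ^ (m + (n - j))) ^ k) =
            (if j = m then complex_of_real (v $ m) * of_nat n else 0)"
        proof (cases "j = m")
          case True
          then show ?thesis using m w by simp
        next
          case False
          let ?t = "(m + (n - j)) mod n"
          have "w ^ (m + (n - j)) = w ^ ?t" by (simp add: power_mod_root_unity[OF w])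
          moreover have "0 < ?t"
          proof (cases "j < m")
            case True
            then have "m + (n - j) = n + (m - j)" using j by linarith
            then have "?t = (n + (m - j)) mod n" by (simp only:)
            also have "\<dots> = m - j" using True m by (simp only: mod_add_self1) simp
            finally show ?thesis using True by simp
          next
            case F: False
            then show ?thesis using False j by simp
          qed
          moreover have "?t < n" using n by simp
          moreover have "(w ^ (m + (n - j))) ^ n = 1" by (metis mult.commute power_mult power_one w)
          ultimately have "(\<Sum>k<n. (w ^ (m + (n - j))) ^ k) = 0"
            using w_ne[of ?t] by (intro sum_powers_root_unity) (simp_all only:, simp)
          then show ?thesis using False by simp
        qed
      qed
      also have "\<dots> = of_real (v $ m) * of_nat n" using m by simp
      finally show ?thesis using n by simp
    qed
    then have "v = 0\<^sub>v n" using v(1) by (intro eq_vecI) auto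
    with v(2) show False by simp
  qed
  then show thesis using that unfolding C_def w_def by blast
qed

text \<open>A root \<open>\<zeta>\<^sub>n ^ k\<close> equals \<open>\<zeta>\<^sub>d\<close> raised
  to an exponent coprime to \<open>d\<close>, where \<open>d = n / gcd k n\<close>. Since the
  coefficients are integers, the root can be conjugated to \<open>\<zeta>\<^sub>d\<close>
  itself.\<close>

lemma circulant_singular_iff:
  assumes n: "n > 0"
  shows "\<not> invertible_mat (circulant_mat n (\<lambda>j. of_bool (\<omega> j) :: real)) \<longleftrightarrow>
    (\<exists>d. d dvd n \<and> (\<Sum>j<n. of_bool (\<omega> j) * cis (2 * pi / real d) ^ j) = 0)"
    (is "?L \<longleftrightarrow> ?R")
proof
  assume ?R
  then obtain d where d: "d dvd n" "(\<Sum>j<n. of_bool (\<omega> j) * cis (2 * pi / real d) ^ j) = 0" by auto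
  have "d > 0" using d n by (auto intro: Nat.gr0I)
  then have "cis (2 * pi / real d) ^ n = 1"
    using d(1) by (auto simp: power_mult cis_power_order elim!: dvdE)
  moreover have "(of_real (of_bool b) :: complex) = of_bool b" for b by (cases b) auto
  ultimately show ?L using d(2) by (intro circulant_root_imp_singular[OF n]) (simp_all only:)
next
  assume ?L
  then obtain k where k: "k < n"
    "(\<Sum>j<n. of_real (of_bool (\<omega> j)) * (cis (2 * pi / real n) ^ k) ^ j) = 0"
    by (rule circulant_singular_imp_root[OF n])
  define g :: "int poly" where "g = (\<Sum>j<n. Polynomial.monom (of_bool (\<omega> j)) j)"
  have g: "int_poly_at g z = (\<Sum>j<n. of_bool (\<omega> j) * z ^ j)" for z
    unfolding g_def of_int_poly_hom.hom_sum poly_sum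
    by (intro sum.cong refl) (simp add: map_poly_monom poly_monom)
  define e where "e = gcd k n"
  define d where "d = n div e"
  have "e > 0" using n by (simp add: e_def)
  have ne: "n = d * e" and ke: "k = k div e * e" by (simp_all add: d_def e_def)
  have "d > 0" using n ne by (auto intro: Nat.gr0I)
  have cop: "coprime (k div e) d" unfolding d_def e_def using n by (intro div_gcd_coprime) auto
  define z where "z = cis (2 * pi / real d) ^ (k div e)"
  have "cis (2 * pi / real n) ^ k = z"
  proof -
    have "real k = real (k div e) * real e" using ke by (metis of_nat_mult)
    moreover have "real n = real d * real e" using ne by (metis of_nat_mult)
    ultimately have "real k * (2 * pi / real n) = real (k div e) * (2 * pi / real d)"
      using \<open>e > 0\<close> by simp
    then show ?thesis unfolding z_def Complex.DeMoivre by simp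
  qed
  moreover have "(of_real (of_bool b) :: complex) = of_bool b" for b by (cases b) auto
  ultimately have "int_poly_at g z = 0" using k(2) by (simp only: g)
  \<comment> \<open>\<open>m\<close> inverts the exponent of \<open>z\<close> modulo
    \<open>d\<close>, so \<open>z ^ m\<close> is \<open>\<zeta>\<^sub>d\<close>.\<close>
  obtain m where m: "[(k div e) * m = 1] (mod d)" using cong_solve_coprime_nat[OF cop] by auto
  then have "coprime m d" by (metis coprime_1_left cong_imp_coprime cong_sym coprime_mult_left_iff)
  have "z ^ d = 1" unfolding z_def by (metis \<open>d > 0\<close> cis_power_order mult.commute power_mult power_one)
  then have "int_poly_at g (z ^ m) = 0"
    using int_poly_root_unity_power_coprime \<open>d > 0\<close> \<open>coprime m d\<close> \<open>int_poly_at g z = 0\<close> by blast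
  also have "z ^ m = cis (2 * pi / real d)"
    unfolding z_def power_mult[symmetric]
    using power_cong_root_unity[OF cis_power_order[OF \<open>d > 0\<close>] m] by simp
  finally show ?R using ne g by (intro exI[of _ d]) auto
qed

section \<open>Coefficients modulo \<open>z ^ d - 1\<close>\<close>

definition residue_count :: "nat \<Rightarrow> nat \<Rightarrow> (nat \<Rightarrow> bool) \<Rightarrow> nat \<Rightarrow> nat" where
  "residue_count n d \<omega> r = card {j \<in> {j. j < n \<and> j mod d = r}. \<omega> j}"

lemma sum_cis_residue_count:
  assumes "d > 0"
  shows "(\<Sum>j<n. of_bool (\<omega> j) * cis (2 * pi / real d) ^ j) =
    (\<Sum>r<d. of_nat (residue_count n d \<omega> r) * cis (2 * pi / real d) ^ r)"
proof -
  let ?z = "cis (2 * pi / real d)"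
  have "(\<Sum>j<n. of_bool (\<omega> j) * ?z ^ j) = (\<Sum>r<d. \<Sum>j\<in>{j\<in>{..<n}. j mod d = r}. of_bool (\<omega> j) * ?z ^ j)"
    by (rule sum.group[symmetric]) (use assms in auto)
  also have "\<dots> = (\<Sum>r<d. of_nat (residue_count n d \<omega> r) * ?z ^ r)"
  proof (intro sum.cong refl)
    fix r
    have "(\<Sum>j\<in>{j\<in>{..<n}. j mod d = r}. of_bool (\<omega> j) * ?z ^ j) =
        (\<Sum>j\<in>{j\<in>{..<n}. j mod d = r}. of_bool (\<omega> j) * ?z ^ r)"
      by (intro sum.cong refl) (auto simp: power_mod_root_unity[OF cis_power_order[OF assms]])
    also have "\<dots> = (\<Sum>j\<in>{j\<in>{j. j < n \<and> j mod d = r}. \<omega> j}. ?z ^ r)"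
      by (rule sum.mono_neutral_cong_right) auto
    finally show "(\<Sum>j\<in>{j\<in>{..<n}. j mod d = r}. of_bool (\<omega> j) * ?z ^ j) =
      of_nat (residue_count n d \<omega> r) * ?z ^ r" by (simp add: residue_count_def)
  qed
  finally show ?thesis .
qed

text \<open>The difference of the two tuples is an integer polynomial with root
  \<open>\<zeta>\<^sub>d\<close>; agreement from index \<open>totient d\<close> on pushes its degree
  below \<open>totient d\<close>, so it vanishes.\<close>

lemma cis_sum_determined:
  fixes x y :: "nat \<Rightarrow> nat"
  assumes d: "d > 0"
    and x: "(\<Sum>r<d. of_nat (x r) * cis (2 * pi / real d) ^ r) = 0"
    and y: "(\<Sum>r<d. of_nat (y r) * cis (2 * pi / real d) ^ r) = 0"
    and eq: "\<And>r. r \<in> {totient d..<d} \<Longrightarrow> x r = y r"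
    and r: "r < d"
  shows "x r = y r"
proof -
  let ?z = "cis (2 * pi / real d)"
  define g :: "int poly" where "g = (\<Sum>r<d. Polynomial.monom (int (x r) - int (y r)) r)"
  have coeff_g: "Polynomial.coeff g r = (if r < d then int (x r) - int (y r) else 0)" for r
    by (simp add: g_def Polynomial.coeff_sum)
  have "int_poly_at g ?z = (\<Sum>r<d. of_nat (x r) * ?z ^ r) - (\<Sum>r<d. of_nat (y r) * ?z ^ r)"
    unfolding g_def of_int_poly_hom.hom_sum poly_sum sum_subtractf[symmetric]
    by (intro sum.cong refl) (simp add: map_poly_monom poly_monom algebra_simps)
  then have root: "int_poly_at g ?z = 0" using x y by simp
  have "g = 0"
  proof (rule int_poly_at_cis_eq_0_imp_eq_0[OF d root])
    have "degree g \<le> totient d - 1"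
      using eq by (intro degree_le) (auto simp: coeff_g)
    moreover have "totient d > 0" using d by simp
    ultimately show "degree g < totient d" by linarith
  qed
  then show ?thesis using coeff_g[of r] r by simp
qed

text \<open>As \<open>totient p = p - 1\<close>, a solution is determined by its last entry, and the
  constant tuple with that entry is a solution because the powers of \<open>\<zeta>\<^sub>p\<close>
  sum to zero.\<close>

lemma cis_sum_prime_eq_0_iff:
  fixes x :: "nat \<Rightarrow> nat"
  assumes p: "prime p"
  shows "(\<Sum>r<p. of_nat (x r) * cis (2 * pi / real p) ^ r) = 0 \<longleftrightarrow> (\<forall>r<p. x r = x 0)"
proof -
  have p2: "p \<ge> 2" using p prime_ge_2_nat by blast
  let ?z = "cis (2 * pi / real p)"
  have "?z \<noteq> 1" using cis_power_neq_1[of 1 p] p2 by simp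
  then have sum0: "(\<Sum>r<p. ?z ^ r) = 0"
    using p2 by (intro sum_powers_root_unity cis_power_order) auto
  have const: "(\<Sum>r<p. of_nat c * ?z ^ r) = 0" for c
    using sum0 by (simp flip: sum_distrib_left)
  show ?thesis
  proof
    assume x: "(\<Sum>r<p. of_nat (x r) * ?z ^ r) = 0"
    have last: "x r = x (p - 1)" if "r < p" for r
    proof (rule cis_sum_determined[where x = x and y = "\<lambda>_. x (p - 1)" and d = p])
      show "x k = x (p - 1)" if "k \<in> {totient p..<p}" for k
      proof -
        have "k = p - 1" using that p p2 by (auto simp: totient_prime)
        then show ?thesis by simp
      qed
    qed (use p2 x const that in auto)
    have "x 0 = x (p - 1)" using p2 by (intro last) simp
    with last show "\<forall>r<p. x r = x 0" by metis
  next
    assume "\<forall>r<p. x r = x 0"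
    then have "(\<Sum>r<p. of_nat (x r) * ?z ^ r) = (\<Sum>r<p. of_nat (x 0) * ?z ^ r)"
      by (intro sum.cong refl) (metis lessThan_iff)
    then show "(\<Sum>r<p. of_nat (x r) * ?z ^ r) = 0" using const by simp
  qed
qed

subsection \<open>Reduction to binomial probabilities\<close>

text \<open>Each block count is binomial and disjoint blocks are independent; the induction splits
  off one block. The value 0 outside \<open>I\<close> matches the default of
  \<open>Pi_pmf\<close>.\<close>

lemma Pi_pmf_bernoulli_block_counts:
  fixes A :: "'i \<Rightarrow> 'a set"
  assumes "finite I" "\<And>i. i \<in> I \<Longrightarrow> finite (A i)" "disjoint_family_on A I" "q \<in> {0..1}"
  shows "map_pmf (\<lambda>\<omega> i. if i \<in> I then card {x \<in> A i. \<omega> x} else 0)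
      (Pi_pmf (\<Union>i\<in>I. A i) False (\<lambda>_. bernoulli_pmf q)) =
    Pi_pmf I 0 (\<lambda>i. binomial_pmf (card (A i)) q)"
  using assms
proof (induction I rule: finite_induct)
  case empty
  then show ?case by simp
next
  case (insert i I)
  let ?P = "\<lambda>X. Pi_pmf X False (\<lambda>_. bernoulli_pmf q)"
  let ?H = "\<lambda>\<omega> i. if i \<in> I then card {x \<in> A i. \<omega> x} else 0"
  have disj: "A i \<inter> (\<Union>k\<in>I. A k) = {}"
    using insert.prems(2) insert.hyps(2) unfolding disjoint_family_on_def by auto
  have fin: "finite (A i)" "finite (\<Union>k\<in>I. A k)" using insert by auto
  have "disjoint_family_on A I"
    using insert.prems(2) unfolding disjoint_family_on_def by auto
  then have IH: "map_pmf ?H (?P (\<Union>k\<in>I. A k)) = Pi_pmf I 0 (\<lambda>i. binomial_pmf (card (A i)) q)"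
    using insert by auto
  have "Pi_pmf (insert i I) 0 (\<lambda>i. binomial_pmf (card (A i)) q) =
      map_pmf (\<lambda>(y, f). f(i := y)) (pair_pmf (binomial_pmf (card (A i)) q) (map_pmf ?H (?P (\<Union>k\<in>I. A k))))"
    unfolding IH using insert by (intro Pi_pmf_insert) auto
  also have "binomial_pmf (card (A i)) q = map_pmf (\<lambda>\<omega>. card {x \<in> A i. \<omega> x}) (?P (A i))"
    using fin insert.prems(3) by (intro binomial_pmf_altdef') auto
  also have "map_pmf (\<lambda>(y, f). f(i := y)) (pair_pmf \<dots> (map_pmf ?H (?P (\<Union>k\<in>I. A k)))) =
      map_pmf (\<lambda>(f, g). (?H g)(i := card {x \<in> A i. f x})) (pair_pmf (?P (A i)) (?P (\<Union>k\<in>I. A k)))"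
    by (simp add: map_pair[symmetric] map_pmf_comp case_prod_unfold)
  \<comment> \<open>The two outcomes are glued into one, \<open>f\<close> on \<open>A i\<close> and
    \<open>g\<close> elsewhere; disjointness leaves the counts of the other blocks
    unchanged.\<close>
  also have "\<dots> = map_pmf (\<lambda>(f, g) k. if k \<in> insert i I
        then card {x \<in> A k. if x \<in> A i then f x else g x} else 0)
      (pair_pmf (?P (A i)) (?P (\<Union>k\<in>I. A k)))"
  proof (intro map_pmf_cong refl)
    fix fg assume "fg \<in> set_pmf (pair_pmf (?P (A i)) (?P (\<Union>k\<in>I. A k)))"
    obtain f g where fg: "fg = (f, g)" by (cases fg)
    have "{x \<in> A i. if x \<in> A i then f x else g x} = {x \<in> A i. f x}" by auto
    moreover have "{x \<in> A k. if x \<in> A i then f x else g x} = {x \<in> A k. g x}" if "k \<in> I" for k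
      using disj that by auto
    ultimately show "(case fg of (f, g) \<Rightarrow> (?H g)(i := card {x \<in> A i. f x})) =
        (case fg of (f, g) \<Rightarrow> \<lambda>k. if k \<in> insert i I
          then card {x \<in> A k. if x \<in> A i then f x else g x} else 0)"
      unfolding fg using insert.hyps(2) by (auto simp: fun_eq_iff simp del: if_split)
  qed
  also have "\<dots> = map_pmf (\<lambda>\<omega> k. if k \<in> insert i I then card {x \<in> A k. \<omega> x} else 0)
      (?P (A i \<union> (\<Union>k\<in>I. A k)))"
    by (subst Pi_pmf_union[OF fin disj]) (simp add: map_pmf_comp case_prod_unfold)
  finally show ?case by simp
qed

lemma card_residue_class:
  assumes "d dvd n" "r < d"
  shows "card {j. j < n \<and> j mod d = r} = n div d"
proof -
  have "bij_betw (\<lambda>k. k * d + r) {..<n div d} {j. j < n \<and> j mod d = r}"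
  proof (rule bij_betw_byWitness[where f' = "\<lambda>j. j div d"])
    have "k * d + r < n" if "k < n div d" for k
    proof -
      have "k * d + r < Suc k * d" using assms(2) by simp
      also have "\<dots> \<le> n div d * d" using that by (intro mult_le_mono1) simp
      also have "\<dots> \<le> n" by simp
      finally show ?thesis .
    qed
    then show "(\<lambda>k. k * d + r) ` {..<n div d} \<subseteq> {j. j < n \<and> j mod d = r}"
      using assms(2) by auto
    show "(\<lambda>j. j div d) ` {j. j < n \<and> j mod d = r} \<subseteq> {..<n div d}"
      using assms by (auto simp: less_mult_imp_div_less mult.commute elim!: dvdE)
  qed (use assms(2) in auto)
  then show ?thesis using bij_betw_same_card by fastforce
qed

lemma map_residue_count:
  assumes "d dvd n" "d > 0" "q \<in> {0..1}"
  shows "map_pmf (residue_count n d) (Pi_pmf {..<n} False (\<lambda>_. bernoulli_pmf q)) =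
    Pi_pmf {..<d} 0 (\<lambda>_. binomial_pmf (n div d) q)"
proof -
  define A where "A = (\<lambda>r. {j. j < n \<and> j mod d = r})"
  have U: "(\<Union>r\<in>{..<d}. A r) = {..<n}" using assms(2) by (auto simp: A_def)
  \<comment> \<open>No index has residue \<open>r\<close> when \<open>r\<close> is at least
    \<open>d\<close>, so the count there is the default 0.\<close>
  have "residue_count n d = (\<lambda>\<omega> r. if r \<in> {..<d} then card {x \<in> A r. \<omega> x} else 0)"
    using assms(2) by (auto simp: fun_eq_iff residue_count_def A_def)
  then have "map_pmf (residue_count n d) (Pi_pmf {..<n} False (\<lambda>_. bernoulli_pmf q)) =
      Pi_pmf {..<d} 0 (\<lambda>r. binomial_pmf (card (A r)) q)"
    using Pi_pmf_bernoulli_block_counts[of "{..<d}" A q] assms(3) unfolding U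
    by (auto simp: A_def disjoint_family_on_def)
  also have "\<dots> = Pi_pmf {..<d} 0 (\<lambda>_. binomial_pmf (n div d) q)"
    using card_residue_class[OF assms(1)] by (intro Pi_pmf_cong) (auto simp: A_def)
  finally show ?thesis .
qed

text \<open>Fix the coordinates outside \<open>B\<close>. At most one completion on \<open>B\<close>
  lands in \<open>E\<close>, and by independence it has probability at most
  \<open>m ^ card B\<close>; averaging over the fixed coordinates preserves this bound.\<close>

lemma prob_Pi_pmf_determined_le:
  assumes A: "finite A" "B \<subseteq> A"
    and det: "\<And>x y. x \<in> E \<Longrightarrow> y \<in> E \<Longrightarrow> (\<And>i. i \<in> A - B \<Longrightarrow> x i = y i) \<Longrightarrow> (\<And>i. i \<in> B \<Longrightarrow> x i = y i)"
    and m: "\<And>i y. i \<in> B \<Longrightarrow> pmf (P i) y \<le> m"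
  shows "measure_pmf.prob (Pi_pmf A dflt P) E \<le> m ^ card B"
proof (cases "B = {}")
  case True
  then show ?thesis by simp
next
  case False
  have finB: "finite B" "finite (A - B)" using A finite_subset by auto
  have m0: "0 \<le> m" using False m pmf_nonneg order_trans by (metis all_not_in_conv)
  let ?P = "Pi_pmf B dflt P" and ?Q = "Pi_pmf (A - B) dflt P"
  define h where "h = (\<lambda>g f x. if x \<in> B then f x else (g x :: 'b))"
  have bound: "emeasure (map_pmf (h g) ?P) E \<le> ennreal (m ^ card B)" for g
  proof -
    have "measure_pmf.prob ?P (h g -` E) \<le> m ^ card B"
    proof (cases "h g -` E \<inter> set_pmf ?P = {}")
      case True
      then have "measure_pmf.prob ?P (h g -` E) = 0"
        by (metis measure_Int_set_pmf measure_empty)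
      then show ?thesis using m0 by simp
    next
      case False
      then obtain f0 where f0: "f0 \<in> h g -` E" "f0 \<in> set_pmf ?P" by auto
      have out: "f i = dflt" if "f \<in> set_pmf ?P" "i \<notin> B" for f i
        using set_Pi_pmf_subset[OF finB(1), of dflt P] that by auto
      have "h g -` E \<inter> set_pmf ?P \<subseteq> {f0}"
      proof
        fix f assume f: "f \<in> h g -` E \<inter> set_pmf ?P"
        have "f i = f0 i" for i
        proof (cases "i \<in> B")
          case True
          have "h g f i = h g f0 i"
            by (rule det[of "h g f" "h g f0"]) (use f f0 True in \<open>auto simp: h_def\<close>)
          then show ?thesis using True by (simp add: h_def)
        next
          case False
          then show ?thesis using f f0 out[of f i] out[of f0 i] by simp
        qed
        then show "f \<in> {f0}" by auto
      qed
      then have "measure_pmf.prob ?P (h g -` E \<inter> set_pmf ?P) \<le> measure_pmf.prob ?P {f0}"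
        by (intro measure_pmf.finite_measure_mono) auto
      then have "measure_pmf.prob ?P (h g -` E) \<le> pmf ?P f0"
        by (simp add: measure_Int_set_pmf measure_pmf_single)
      also have "\<dots> = (\<Prod>i\<in>B. pmf (P i) (f0 i))"
        using finB(1) out f0(2) by (intro pmf_Pi') auto
      also have "\<dots> \<le> (\<Prod>i\<in>B. m)" using m by (intro prod_mono) auto
      finally show ?thesis by simp
    qed
    then show ?thesis by (simp add: measure_pmf.emeasure_eq_measure ennreal_leI)
  qed
  have "A = B \<union> (A - B)" using A by auto
  then have "Pi_pmf A dflt P = map_pmf (\<lambda>(f, g) x. if x \<in> B then f x else g x) (pair_pmf ?P ?Q)"
    using Pi_pmf_union[OF finB, of dflt P] by auto
  also have "\<dots> = bind_pmf ?Q (\<lambda>g. map_pmf (h g) ?P)"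
    unfolding pair_pmf_def map_pmf_def h_def
    by (subst bind_commute_pmf) (simp add: bind_assoc_pmf bind_return_pmf)
  finally have "emeasure (Pi_pmf A dflt P) E = (\<integral>\<^sup>+g. emeasure (map_pmf (h g) ?P) E \<partial>?Q)"
    by simp
  also have "\<dots> \<le> (\<integral>\<^sup>+g. ennreal (m ^ card B) \<partial>?Q)"
    by (intro nn_integral_mono bound)
  also have "\<dots> = ennreal (m ^ card B)" by simp
  finally show ?thesis using m0 by (simp add: measure_pmf.emeasure_eq_measure)
qed

text \<open>Up to outcomes of mass zero, the event consists of the functions \<open>?F k\<close>
  with \<open>k\<close> at most \<open>N\<close>, and each has a product mass of \<open>p\<close>
  equal factors.\<close>

lemma prob_Pi_binomial_pmf_all_equal:
  assumes p: "p > 0" and q: "q \<in> {0..1}"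
  shows "measure_pmf.prob (Pi_pmf {..<p} 0 (\<lambda>_. binomial_pmf N q)) {x. \<forall>r<p. x r = x 0} =
    (\<Sum>k = 0..N. binomial_mass q k N ^ p)"
proof -
  let ?P = "Pi_pmf {..<p} 0 (\<lambda>_. binomial_pmf N q)"
  let ?F = "\<lambda>k r. if r < p then k else (0 :: nat)"
  have mass: "pmf (binomial_pmf N q) k = binomial_mass q k N" for k
    using q by (simp add: binomial_mass_def)
  have pmfF: "pmf ?P (?F k) = binomial_mass q k N ^ p" for k
    by (subst pmf_Pi') (auto simp: mass)
  have "measure_pmf.prob ?P {x. \<forall>r<p. x r = x 0} = measure_pmf.prob ?P (?F ` {0..N})"
  proof (rule measure_prob_cong_0)
    fix x assume x: "x \<in> {x. \<forall>r<p. x r = x 0} - ?F ` {0..N}"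
    show "pmf ?P x = 0"
    proof (rule ccontr)
      assume nz: "pmf ?P x \<noteq> 0"
      then have out: "x r = 0" if "\<not> r < p" for r
        using that by (metis finite_lessThan lessThan_iff pmf_Pi_outside)
      have eq: "x r = x 0" if "r < p" for r using x that by blast
      have "x = ?F (x 0)"
      proof
        fix r show "x r = ?F (x 0) r" using eq[of r] out[of r] by presburger
      qed
      moreover have "x 0 \<le> N"
      proof (rule ccontr)
        assume "\<not> x 0 \<le> N"
        then have "pmf ?P (?F (x 0)) = 0" unfolding pmfF binomial_mass_def using p
          by (simp add: binomial_eq_0)
        with nz show False using \<open>x = ?F (x 0)\<close> by metis
      qed
      ultimately have "x \<in> ?F ` {0..N}" by (intro image_eqI[where x = "x 0"]) simp_all
      with x show False by blast
    qed
  next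
    fix x assume "x \<in> ?F ` {0..N} - {x. \<forall>r<p. x r = x 0}"
    then show "pmf ?P x = 0" using p by auto
  qed
  also have "\<dots> = (\<Sum>x\<in>?F ` {0..N}. pmf ?P x)" by (intro measure_measure_pmf_finite) auto
  also have "\<dots> = (\<Sum>k = 0..N. binomial_mass q k N ^ p)"
  proof (subst sum.reindex)
    show "inj_on ?F {0..N}" using p by (auto simp: inj_on_def fun_eq_iff)
  qed (simp add: pmfF o_def)
  finally show ?thesis .
qed

text \<open>This is the \<open>m(N)\<close> of the opening comment.\<close>

definition binomial_peak :: "real \<Rightarrow> nat \<Rightarrow> real" where
  "binomial_peak q N = Max ((\<lambda>k. binomial_mass q k N) ` {..N})"

lemma binomial_mass_nonneg: "q \<in> {0..1} \<Longrightarrow> 0 \<le> binomial_mass q k N"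
  by (simp add: binomial_mass_def)

lemma binomial_mass_le_peak:
  assumes "q \<in> {0..1}"
  shows "binomial_mass q k N \<le> binomial_peak q N"
proof (cases "k \<le> N")
  case True
  then show ?thesis unfolding binomial_peak_def by (intro Max_ge) auto
next
  case False
  have "0 \<le> binomial_mass q 0 N" using assms by (rule binomial_mass_nonneg)
  also have "\<dots> \<le> binomial_peak q N" unfolding binomial_peak_def by (intro Max_ge) auto
  finally show ?thesis using False by (simp add: binomial_mass_def binomial_eq_0)
qed

lemma prime_smallest_prime_divisor:
  assumes "n \<ge> 2"
  shows "prime (smallest_prime_divisor n)" "smallest_prime_divisor n dvd n"
    "prime r \<Longrightarrow> r dvd n \<Longrightarrow> smallest_prime_divisor n \<le> r"
proof -
  obtain p where "prime p \<and> p dvd n" using assms prime_factor_nat by fastforce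
  from LeastI[of "\<lambda>p. prime p \<and> p dvd n", OF this]
  show "prime (smallest_prime_divisor n)" "smallest_prime_divisor n dvd n"
    by (simp_all add: smallest_prime_divisor_def)
  show "prime r \<Longrightarrow> r dvd n \<Longrightarrow> smallest_prime_divisor n \<le> r"
    unfolding smallest_prime_divisor_def by (intro Least_le) simp
qed

context
  fixes q :: real and n :: nat
  assumes q: "q \<in> {0..1}" and n: "n > 0"
begin

lemma prob_cis_sum_eq_0:
  assumes "d dvd n"
  shows "measure_pmf.prob (Pi_pmf {..<n} False (\<lambda>_. bernoulli_pmf q))
      {\<omega>. (\<Sum>j<n. of_bool (\<omega> j) * cis (2 * pi / real d) ^ j) = 0} =
    measure_pmf.prob (Pi_pmf {..<d} 0 (\<lambda>_. binomial_pmf (n div d) q))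
      {x. (\<Sum>r<d. of_nat (x r) * cis (2 * pi / real d) ^ r) = 0}"
proof -
  have d: "d > 0" using assms n by (auto intro: Nat.gr0I)
  show ?thesis
    unfolding sum_cis_residue_count[OF d] map_residue_count[OF assms d q, symmetric]
    by (simp add: vimage_def)
qed

lemma prob_cis_sum_eq_0_le:
  assumes "d dvd n"
  shows "measure_pmf.prob (Pi_pmf {..<n} False (\<lambda>_. bernoulli_pmf q))
      {\<omega>. (\<Sum>j<n. of_bool (\<omega> j) * cis (2 * pi / real d) ^ j) = 0} \<le>
    binomial_peak q (n div d) ^ totient d"
proof -
  have d: "d > 0" using assms n by (auto intro: Nat.gr0I)
  have le: "totient d \<le> d" by (rule totient_le)
  let ?E = "{x. (\<Sum>r<d. of_nat (x r) * cis (2 * pi / real d) ^ r) = 0}"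
  have "measure_pmf.prob (Pi_pmf {..<d} 0 (\<lambda>_. binomial_pmf (n div d) q)) ?E \<le>
      binomial_peak q (n div d) ^ card {..<totient d}"
  proof (rule prob_Pi_pmf_determined_le)
    show "pmf (binomial_pmf (n div d) q) y \<le> binomial_peak q (n div d)" for y
      using binomial_mass_le_peak[OF q, of y "n div d"] q by (simp add: binomial_mass_def)
    fix x y i
    assume xy: "x \<in> ?E" "y \<in> ?E" and eq: "\<And>i. i \<in> {..<d} - {..<totient d} \<Longrightarrow> x i = y i"
      and i: "i \<in> {..<totient d}"
    show "x i = y i"
    proof (rule cis_sum_determined[where x = x and y = y and d = d])
      show "x r = y r" if "r \<in> {totient d..<d}" for r using that by (intro eq) auto
    qed (use xy i le d in auto)
  qed (use le in auto)
  then show ?thesis using prob_cis_sum_eq_0[OF assms] by simp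
qed

text \<open>Singularity is the union of the events \<open>E d\<close>. The event of \<open>p\<close>
  alone has probability \<open>S\<close>; a union bound handles the rest.\<close>

lemma prob_singular_circulant_bounds:
  fixes p :: nat
  assumes p: "prime p" "p dvd n"
  defines "S \<equiv> (\<Sum>k = 0..n div p. binomial_mass q k (n div p) ^ p)"
  shows "S \<le> prob_singular_circulant q n"
    and "prob_singular_circulant q n \<le>
      S + (\<Sum>d | d dvd n \<and> d \<noteq> 1 \<and> d \<noteq> p. binomial_peak q (n div d) ^ totient d)"
proof -
  let ?P = "Pi_pmf {..<n} False (\<lambda>_. bernoulli_pmf q)"
  define E where "E = (\<lambda>d. {\<omega>. (\<Sum>j<n. of_bool (\<omega> j) * cis (2 * pi / real d) ^ j) = 0})"
  let ?D = "{d. d dvd n \<and> d \<noteq> 1 \<and> d \<noteq> p}"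
  have p0: "p > 0" using p prime_gt_0_nat by blast
  have sing: "prob_singular_circulant q n = measure_pmf.prob ?P (\<Union>d\<in>{d. d dvd n}. E d)"
    unfolding prob_singular_circulant_def circulant_singular_iff[OF n] E_def
    by (intro arg_cong[where f = "measure_pmf.prob ?P"]) auto
  have S: "measure_pmf.prob ?P (E p) = S"
    unfolding E_def prob_cis_sum_eq_0[OF p(2)] cis_sum_prime_eq_0_iff[OF p(1)] S_def
    by (rule prob_Pi_binomial_pmf_all_equal[OF p0 q])
  show "S \<le> prob_singular_circulant q n"
    unfolding sing S[symmetric] using p(2) by (intro measure_pmf.finite_measure_mono) auto
  \<comment> \<open>At \<open>d = 1\<close> the sum counts the entries equal to 1, so it vanishes
    only for the zero matrix, which also lies in \<open>E p\<close>.\<close>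
  have "E 1 \<subseteq> E p"
  proof
    fix \<omega> assume "\<omega> \<in> E 1"
    then have "(\<Sum>j<n. of_bool (\<omega> j) :: complex) = 0" by (simp add: E_def)
    then have "real (card {j\<in>{..<n}. \<omega> j}) = 0"
      by (simp add: of_bool_def sum.If_cases Int_def)
    then have "\<not> \<omega> j" if "j < n" for j using that by auto
    then show "\<omega> \<in> E p" by (auto simp: E_def intro!: sum.neutral)
  qed
  then have "(\<Union>d\<in>{d. d dvd n}. E d) \<subseteq> E p \<union> (\<Union>d\<in>?D. E d)" by fastforce
  then have "prob_singular_circulant q n \<le> measure_pmf.prob ?P (E p \<union> (\<Union>d\<in>?D. E d))"
    unfolding sing by (intro measure_pmf.finite_measure_mono) auto
  also have "\<dots> \<le> measure_pmf.prob ?P (E p) + measure_pmf.prob ?P (\<Union>d\<in>?D. E d)"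
    by (intro measure_Un_le) auto
  also have "measure_pmf.prob ?P (\<Union>d\<in>?D. E d) \<le> (\<Sum>d\<in>?D. measure_pmf.prob ?P (E d))"
    using n by (intro measure_pmf.finite_measure_subadditive_finite) auto
  also have "\<dots> \<le> (\<Sum>d\<in>?D. binomial_peak q (n div d) ^ totient d)"
    unfolding E_def by (intro sum_mono prob_cis_sum_eq_0_le) auto
  finally show "prob_singular_circulant q n \<le>
      S + (\<Sum>d\<in>?D. binomial_peak q (n div d) ^ totient d)"
    using S by simp
qed

end

subsection \<open>The largest binomial probability\<close>

context
  fixes q :: real
  assumes q0: "0 < q" and q1: "q < 1"
begin

lemma prob_in_unit_interval: "q \<in> {0..1}"
  using q0 q1 by simp

lemma mass_nonneg: "0 \<le> binomial_mass q k N"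
  by (rule binomial_mass_nonneg[OF prob_in_unit_interval])

section \<open>Ratios of consecutive binomial masses\<close>

lemma binomial_mass_Suc_index:
  assumes "k \<le> N"
  shows "real (Suc k) * (1 - q) * binomial_mass q (Suc k) N = (real N - real k) * q * binomial_mass q k N"
proof (cases "k = N")
  case True
  then show ?thesis by (simp add: binomial_mass_def)
next
  case False
  then have k: "k < N" using assms by simp
  have "Suc k * (N choose Suc k) = (N - k) * (N choose k)"
    by (simp only: binomial_absorption binomial_absorb_comp)
  then have ch: "real (Suc k) * real (N choose Suc k) = (real N - real k) * real (N choose k)"
    using k by (metis of_nat_diff of_nat_mult less_imp_le)
  have pw: "(1 - q) * (1 - q) ^ (N - Suc k) = (1 - q) ^ (N - k)"
    using k by (metis Suc_diff_Suc power_Suc)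
  have "real (Suc k) * (1 - q) * binomial_mass q (Suc k) N =
      (real (Suc k) * real (N choose Suc k)) * (q * q ^ k) * ((1 - q) * (1 - q) ^ (N - Suc k))"
    by (simp only: binomial_mass_def power_Suc mult_ac)
  also have "\<dots> = (real N - real k) * q * binomial_mass q k N"
    unfolding ch pw by (simp only: binomial_mass_def mult_ac)
  finally show ?thesis .
qed

lemma binomial_mass_Suc_Suc:
  "binomial_mass q (Suc k) (Suc N) = q * binomial_mass q k N + (1 - q) * binomial_mass q (Suc k) N"
proof (cases "k < N")
  case True
  then have pw: "(1 - q) * (1 - q) ^ (N - Suc k) = (1 - q) ^ (N - k)"
    by (metis Suc_diff_Suc power_Suc)
  have eq: "(1 - q) * binomial_mass q (Suc k) N =
      real (N choose Suc k) * (q * q ^ k) * ((1 - q) * (1 - q) ^ (N - Suc k))"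
    by (simp only: binomial_mass_def power_Suc mult_ac)
  show ?thesis unfolding eq pw by (simp add: binomial_mass_def distrib_right distrib_left mult_ac)
next
  case False
  then show ?thesis by (simp add: binomial_mass_def binomial_eq_0)
qed

lemma sum_binomial_mass: "(\<Sum>k = 0..N. binomial_mass q k N) = 1"
  using binomial_ring[of q "1 - q" N] by (simp add: binomial_mass_def atLeast0AtMost)

lemma binomial_peak_attained:
  obtains k where "k \<le> N" "binomial_mass q k N = binomial_peak q N"
proof -
  have "binomial_peak q N \<in> (\<lambda>k. binomial_mass q k N) ` {..N}"
    unfolding binomial_peak_def by (intro Max_in) auto
  with that show thesis by auto
qed

lemma binomial_peak_ge: "binomial_peak q N \<ge> 1 / (real N + 1)"
proof -
  have "1 = (\<Sum>k = 0..N. binomial_mass q k N)" by (simp add: sum_binomial_mass)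
  also have "\<dots> \<le> (\<Sum>k = 0..N. binomial_peak q N)"
    by (intro sum_mono binomial_mass_le_peak[OF prob_in_unit_interval])
  finally show ?thesis by (simp add: field_simps)
qed

lemma binomial_peak_pos: "binomial_peak q N > 0"
proof -
  have "0 < 1 / (real N + 1)" by simp
  then show ?thesis using binomial_peak_ge[of N] by linarith
qed

text \<open>The mass at a mode is at least that of its predecessor, and the ratio of the two turns
  this into a bound on the index.\<close>

lemma binomial_mode_le:
  assumes "k \<le> N" "binomial_mass q k N = binomial_peak q N"
  shows "real k \<le> (real N + 1) * q"
proof (cases k)
  case 0
  then show ?thesis using q0 by simp
next
  case (Suc j)
  have "real k * (1 - q) * binomial_peak q N = (real N - real j) * q * binomial_mass q j N"
    using binomial_mass_Suc_index[of j N] assms Suc by simp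
  also have "\<dots> \<le> (real N - real j) * q * binomial_peak q N"
    using q0 Suc assms by (intro mult_left_mono binomial_mass_le_peak[OF prob_in_unit_interval]) auto
  finally have "real k * (1 - q) \<le> (real N - real j) * q"
    using binomial_peak_pos[of N] by simp
  then show ?thesis using Suc by (simp add: algebra_simps)
qed

text \<open>
  \<open>A\<close> is the variance, and \<open>(N + 1) q\<close> bounds the mode from above.
\<close>

lemma binomial_mass_Suc_ge:
  fixes N :: nat
  defines "A \<equiv> real N * q * (1 - q)"
  assumes N: "N > 0" and k: "real k \<le> (real N + 1) * q + real i"
  shows "binomial_mass q (Suc k) N \<ge> (1 - (real i + 1) / A) * binomial_mass q k N"
proof (cases "k \<le> N \<and> (real i + 1) / A < 1")
  case False
  show ?thesis
  proof (cases "k \<le> N")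
    case True
    then have "(1 - (real i + 1) / A) * binomial_mass q k N \<le> 0"
      using False mass_nonneg by (intro mult_nonpos_nonneg) auto
    also have "\<dots> \<le> binomial_mass q (Suc k) N" by (rule mass_nonneg)
    finally show ?thesis .
  next
    case False
    then show ?thesis by (simp add: binomial_mass_def binomial_eq_0)
  qed
next
  case True
  then have kN: "k \<le> N" and lt: "(real i + 1) / A < 1" by auto
  have A: "A > 0" using N q0 q1 by (simp add: A_def)
  \<comment> \<open>\<open>U / D\<close> is the ratio of the two masses. If \<open>D\<close> is at
    least \<open>A\<close>, the bound on \<open>U - D\<close> suffices; otherwise the bound on
    \<open>U\<close> alone does.\<close>
  define D where "D = real (Suc k) * (1 - q)"
  define U where "U = (real N - real k) * q"
  have D0: "D > 0" using q1 by (simp add: D_def)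
  have eq: "D * binomial_mass q (Suc k) N = U * binomial_mass q k N"
    using binomial_mass_Suc_index[OF kN] by (simp add: D_def U_def)
  have qk: "q * real k \<le> q * ((real N + 1) * q + real i)" using k q0 by (intro mult_left_mono) auto
  have iq: "real i * q \<le> real i" using q1 q0 by (simp add: mult_left_le)
  have qq: "q * q \<le> 1" using q0 q1 by (simp add: mult_le_one)
  have UA: "U \<ge> A - (real i + 1)"
    using qk iq qq unfolding U_def A_def by (simp add: algebra_simps)
  have UD: "U - D \<ge> - (real i + 1)"
    using k unfolding U_def D_def by (simp add: algebra_simps)
  have "U \<ge> (1 - (real i + 1) / A) * D"
  proof (cases "D \<ge> A")
    case True
    have "real i + 1 = (real i + 1) / A * A" using A by simp
    also have "\<dots> \<le> (real i + 1) / A * D" using True A by (intro mult_left_mono) auto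
    finally show ?thesis using UD by (simp add: algebra_simps)
  next
    case False
    have "(1 - (real i + 1) / A) * D \<le> (1 - (real i + 1) / A) * A"
      using False lt by (intro mult_left_mono) auto
    also have "\<dots> = A - (real i + 1)" using A by (simp add: field_simps)
    finally show ?thesis using UA by simp
  qed
  then have "(1 - (real i + 1) / A) * D * binomial_mass q k N \<le> U * binomial_mass q k N"
    using mass_nonneg by (intro mult_right_mono)
  then have "D * ((1 - (real i + 1) / A) * binomial_mass q k N) \<le> D * binomial_mass q (Suc k) N"
    unfolding eq by (simp only: mult_ac)
  then show ?thesis using D0 by simp
qed

text \<open>The one-step factors \<open>1 - i / A\<close> for \<open>i\<close> from 1 to
  \<open>j\<close> have a product of at least one minus the sum of the \<open>i / A\<close>. Once a
  factor is no longer positive, the claimed lower bound is not positive either.\<close>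

lemma binomial_mass_near_mode:
  fixes N :: nat
  defines "A \<equiv> real N * q * (1 - q)"
  assumes N: "N > 0" and k: "k \<le> N" "binomial_mass q k N = binomial_peak q N"
  shows "binomial_mass q (k + j) N \<ge> (1 - real j * (real j + 1) / (2 * A)) * binomial_peak q N"
proof (induction j)
  case 0
  then show ?case using k by simp
next
  case (Suc j)
  have A: "A > 0" using N q0 q1 by (simp add: A_def)
  let ?c = "\<lambda>j. 1 - real j * (real j + 1) / (2 * A)"
  show ?case
  proof (cases "(real j + 1) / A < 1")
    case True
    have "?c (Suc j) = ?c j - (real j + 1) / A"
      using A by (simp add: field_simps)
    also have "\<dots> \<le> (1 - (real j + 1) / A) * ?c j"
    proof -
      have "1 - b - a \<le> (1 - a) * (1 - b)" if "0 \<le> a * b" for a b :: real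
        using that by (simp add: algebra_simps)
      then show ?thesis using A by simp
    qed
    finally have "?c (Suc j) * binomial_peak q N \<le> (1 - (real j + 1) / A) * (?c j * binomial_peak q N)"
      using binomial_peak_pos[of N] by (simp add: mult.assoc[symmetric])
    also have "\<dots> \<le> (1 - (real j + 1) / A) * binomial_mass q (k + j) N"
      using Suc True by (intro mult_left_mono) auto
    also have "\<dots> \<le> binomial_mass q (Suc (k + j)) N"
      unfolding A_def using N binomial_mode_le[OF k] by (intro binomial_mass_Suc_ge) auto
    finally show ?thesis by simp
  next
    case False
    have "1 \<le> (real j + 1) / A * 1" using False by simp
    also have "\<dots> \<le> (real j + 1) / A * ((real j + 2) / 2)"
      using A by (intro mult_left_mono) auto
    also have "\<dots> = real (Suc j) * (real (Suc j) + 1) / (2 * A)" by (simp add: field_simps)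
    finally have "?c (Suc j) * binomial_peak q N \<le> 0"
      using binomial_peak_pos[of N] by (intro mult_nonpos_nonneg) auto
    also have "\<dots> \<le> binomial_mass q (k + Suc j) N" by (rule mass_nonneg)
    finally show ?thesis .
  qed
qed

text \<open>For \<open>j < sqrt A / 2\<close> one has
  \<open>j (j + 1) \<le> 2 j^2 \<le> A / 2\<close>, so about \<open>sqrt A / 2\<close> masses from
  the mode upwards are at least half the peak. The case \<open>s = 1\<close> bounds the peak from
  above, and \<open>s = 2\<close> gives the saving needed for \<open>p = 2\<close>.\<close>

lemma sum_binomial_mass_power_ge:
  fixes N :: nat
  assumes N: "N > 0"
  shows "(\<Sum>k = 0..N. binomial_mass q k N ^ s) \<ge> sqrt (real N * q * (1 - q)) / 2 * (binomial_peak q N / 2) ^ s"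
proof -
  define A where "A = real N * q * (1 - q)"
  have A: "A > 0" using N q0 q1 by (simp add: A_def)
  obtain k where k: "k \<le> N" "binomial_mass q k N = binomial_peak q N" by (rule binomial_peak_attained)
  define J where "J = nat \<lceil>sqrt A / 2\<rceil>"
  have ge: "binomial_mass q (k + j) N \<ge> binomial_peak q N / 2" if "j < J" for j
  proof -
    have "real j < sqrt A / 2" using that unfolding J_def by linarith
    then have "(2 * real j) ^ 2 \<le> (sqrt A) ^ 2" by (intro power_mono) auto
    then have "4 * (real j * real j) \<le> A" using A by (simp add: power2_eq_square)
    moreover have "real j \<le> real j * real j" by (cases j) auto
    ultimately have "real j * (real j + 1) / (2 * A) \<le> 1 / 2"
      using A by (simp add: field_simps)
    then have "1 / 2 * binomial_peak q N \<le> (1 - real j * (real j + 1) / (2 * A)) * binomial_peak q N"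
      using binomial_peak_pos[of N] by (intro mult_right_mono) auto
    also have "\<dots> \<le> binomial_mass q (k + j) N"
      unfolding A_def by (rule binomial_mass_near_mode[OF N k])
    finally show ?thesis by simp
  qed
  have sub: "(\<lambda>j. k + j) ` {..<J} \<subseteq> {0..N}"
  proof
    fix x assume "x \<in> (\<lambda>j. k + j) ` {..<J}"
    then have "binomial_mass q x N \<ge> binomial_peak q N / 2" using ge by auto
    then have "binomial_mass q x N > 0" using binomial_peak_pos[of N] by linarith
    then show "x \<in> {0..N}" by (cases "x \<le> N") (auto simp: binomial_mass_def binomial_eq_0)
  qed
  have "sqrt A / 2 * (binomial_peak q N / 2) ^ s \<le> real J * (binomial_peak q N / 2) ^ s"
    using binomial_peak_pos[of N] unfolding J_def by (intro mult_right_mono) (linarith, simp)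
  also have "\<dots> = (\<Sum>j<J. (binomial_peak q N / 2) ^ s)" by simp
  also have "\<dots> \<le> (\<Sum>j<J. binomial_mass q (k + j) N ^ s)"
    using ge binomial_peak_pos[of N] by (intro sum_mono power_mono) (auto intro: less_imp_le)
  also have "\<dots> = (\<Sum>x\<in>(\<lambda>j. k + j) ` {..<J}. binomial_mass q x N ^ s)"
    by (subst sum.reindex) (auto simp: o_def)
  also have "\<dots> \<le> (\<Sum>k = 0..N. binomial_mass q k N ^ s)"
    using sub mass_nonneg by (intro sum_mono2) auto
  finally show ?thesis unfolding A_def .
qed

lemma binomial_peak_le_inverse_sqrt:
  fixes N :: nat
  assumes N: "N > 0"
  shows "binomial_peak q N \<le> 4 / sqrt (q * (1 - q)) / sqrt (real N)"
proof -
  have "sqrt (real N * q * (1 - q)) / 2 * (binomial_peak q N / 2) ^ 1 \<le> (\<Sum>k = 0..N. binomial_mass q k N ^ 1)"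
    by (rule sum_binomial_mass_power_ge[OF N])
  then have "sqrt (real N) * sqrt (q * (1 - q)) * binomial_peak q N \<le> 4"
    by (simp add: sum_binomial_mass real_sqrt_mult mult_ac)
  moreover have "sqrt (real N) * sqrt (q * (1 - q)) > 0" using N q0 q1 by simp
  ultimately show ?thesis by (simp add: field_simps)
qed

lemma binomial_peak_power_le_sum: "binomial_peak q N ^ s \<le> (\<Sum>k = 0..N. binomial_mass q k N ^ s)"
proof -
  obtain k where k: "k \<le> N" "binomial_mass q k N = binomial_peak q N" by (rule binomial_peak_attained)
  have "binomial_mass q k N ^ s \<le> (\<Sum>k = 0..N. binomial_mass q k N ^ s)"
    using k mass_nonneg by (intro member_le_sum) auto
  with k show ?thesis by simp
qed

text \<open>Apply Pascal's rule just above a mode \<open>k\<close> of \<open>N\<close>. The first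
  bound drops the second summand; the second bound estimates it by
  \<open>binomial_mass_Suc_ge\<close> with \<open>i = 0\<close>.\<close>

lemma binomial_peak_Suc_ge:
  fixes N :: nat
  assumes N: "N > 0"
  shows "binomial_peak q (Suc N) \<ge> q * binomial_peak q N"
    and "binomial_peak q (Suc N) \<ge> (1 - 1 / (real N * q)) * binomial_peak q N"
proof -
  obtain k where k: "k \<le> N" "binomial_mass q k N = binomial_peak q N" by (rule binomial_peak_attained)
  have le: "q * binomial_peak q N + (1 - q) * binomial_mass q (Suc k) N \<le> binomial_peak q (Suc N)"
    using binomial_mass_le_peak[OF prob_in_unit_interval, of "Suc k" "Suc N"] k by (simp add: binomial_mass_Suc_Suc)
  moreover have "0 \<le> (1 - q) * binomial_mass q (Suc k) N"
    using q1 by (intro mult_nonneg_nonneg mass_nonneg) auto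
  ultimately show "binomial_peak q (Suc N) \<ge> q * binomial_peak q N" by linarith
  have "(1 - (real 0 + 1) / (real N * q * (1 - q))) * binomial_peak q N \<le> binomial_mass q (Suc k) N"
    using binomial_mass_Suc_ge[OF N, of k 0] binomial_mode_le[OF k] k by simp
  then have "(1 - q) * ((1 - (real 0 + 1) / (real N * q * (1 - q))) * binomial_peak q N) \<le>
      (1 - q) * binomial_mass q (Suc k) N"
    using q1 by (intro mult_left_mono) auto
  moreover have "q * binomial_peak q N + (1 - q) * ((1 - (real 0 + 1) / (real N * q * (1 - q))) * binomial_peak q N) =
      (1 - 1 / (real N * q)) * binomial_peak q N"
    using N q0 q1 by (simp add: field_simps)
  ultimately show "binomial_peak q (Suc N) \<ge> (1 - 1 / (real N * q)) * binomial_peak q N"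
    using le by linarith
qed

text \<open>The value \<open>2 / q^2\<close> dominates \<open>2 / q\<close>, needed when
  \<open>N q \<ge> 2\<close>, and \<open>N / q\<close>, needed when \<open>N q < 2\<close>.\<close>

definition growth_exponent :: nat where
  "growth_exponent = nat \<lceil>2 / q\<^sup>2\<rceil>"

text \<open>Bernoulli's inequality puts the loss \<open>1 + C / N\<close> into the form of a power
  of \<open>(N + 1) / N\<close>, so that successive losses telescope.\<close>

lemma binomial_peak_le_Suc:
  fixes N :: nat
  assumes N: "N > 0"
  shows "binomial_peak q N \<le> ((real N + 1) / real N) ^ growth_exponent * binomial_peak q (Suc N)"
proof -
  let ?C = "growth_exponent"
  have C: "real ?C \<ge> 2 / q\<^sup>2" unfolding growth_exponent_def by linarith
  have q2: "q\<^sup>2 \<le> q" using q0 q1 by (simp add: power2_eq_square)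
  have bern: "1 + real ?C / real N \<le> ((real N + 1) / real N) ^ ?C"
  proof -
    have "1 + real ?C * (1 / real N) \<le> (1 + 1 / real N) ^ ?C"
      by (rule Bernoulli_inequality) (use N in \<open>simp add: order_trans[of _ 0]\<close>)
    moreover have "1 + 1 / real N = (real N + 1) / real N" using N by (simp add: field_simps)
    ultimately show ?thesis by simp
  qed
  have "binomial_peak q N \<le> (1 + real ?C / real N) * binomial_peak q (Suc N)"
  proof (cases "real N * q \<ge> 2")
    case True
    define x where "x = 1 / (real N * q)"
    have x: "0 < x" "x \<le> 1 / 2" using True q0 N by (auto simp: x_def field_simps)
    have "2 * x = (2 / q) / real N" by (simp add: x_def)
    also have "\<dots> \<le> real ?C / real N"
    proof (rule divide_right_mono)
      have "2 / q \<le> 2 / q\<^sup>2" using q0 q2 by (intro divide_left_mono) auto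
      then show "2 / q \<le> real ?C" using C by simp
    qed simp
    finally have "1 + 2 * x \<le> 1 + real ?C / real N" by simp
    \<comment> \<open>This is \<open>1 / (1 - x) \<le> 1 + 2 x\<close> for \<open>x\<close> at most
      one half.\<close>
    have "1 \<le> (1 + 2 * x) * (1 - x)"
    proof -
      have "(1 + 2 * x) * (1 - x) - 1 = x * (1 - 2 * x)" by (simp add: algebra_simps)
      moreover have "0 \<le> x * (1 - 2 * x)" using x by (intro mult_nonneg_nonneg) auto
      ultimately show ?thesis by linarith
    qed
    then have "1 * binomial_peak q N \<le> (1 + 2 * x) * (1 - x) * binomial_peak q N"
      using binomial_peak_pos[of N] by (intro mult_right_mono) auto
    also have "\<dots> = (1 + 2 * x) * ((1 - x) * binomial_peak q N)" by simp
    also have "\<dots> \<le> (1 + 2 * x) * binomial_peak q (Suc N)"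
      using binomial_peak_Suc_ge(2)[OF N] x by (intro mult_left_mono) (auto simp: x_def)
    also have "\<dots> \<le> (1 + real ?C / real N) * binomial_peak q (Suc N)"
      using \<open>1 + 2 * x \<le> _\<close> binomial_peak_pos[of "Suc N"] by (intro mult_right_mono) auto
    finally show ?thesis by simp
  next
    case False
    have "real N < 2 / q" using False q0 by (simp add: field_simps)
    then have "real N * (1 / q) \<le> 2 / q * (1 / q)" using q0 by (intro mult_right_mono) auto
    also have "\<dots> = 2 / q\<^sup>2" by (simp add: power2_eq_square)
    also have "\<dots> \<le> real ?C" by (rule C)
    finally have "1 / q \<le> real ?C / real N" using N by (simp add: field_simps)
    then have "1 / q \<le> 1 + real ?C / real N" by simp
    have "binomial_peak q N = 1 / q * (q * binomial_peak q N)" using q0 by simp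
    also have "\<dots> \<le> 1 / q * binomial_peak q (Suc N)"
      using binomial_peak_Suc_ge(1)[OF N] q0 by (intro mult_left_mono) auto
    also have "\<dots> \<le> (1 + real ?C / real N) * binomial_peak q (Suc N)"
      using \<open>1 / q \<le> 1 + _\<close> binomial_peak_pos[of "Suc N"] by (intro mult_right_mono) auto
    finally show ?thesis .
  qed
  also have "\<dots> \<le> ((real N + 1) / real N) ^ ?C * binomial_peak q (Suc N)"
    using bern binomial_peak_pos[of "Suc N"] by (intro mult_right_mono) auto
  finally show ?thesis .
qed

lemma binomial_peak_ratio_le:
  assumes "0 < M" "M \<le> N"
  shows "binomial_peak q M \<le> (real N / real M) ^ growth_exponent * binomial_peak q N"
  using assms(2)
proof (induction N rule: dec_induct)
  case base
  then show ?case using assms by simp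
next
  case (step N)
  have N: "N > 0" using step assms by linarith
  have "binomial_peak q M \<le> (real N / real M) ^ growth_exponent * binomial_peak q N" by (rule step.IH)
  also have "\<dots> \<le> (real N / real M) ^ growth_exponent *
      (((real N + 1) / real N) ^ growth_exponent * binomial_peak q (Suc N))"
    by (intro mult_left_mono binomial_peak_le_Suc[OF N]) auto
  also have "\<dots> = (real N / real M * ((real N + 1) / real N)) ^ growth_exponent * binomial_peak q (Suc N)"
    by (simp only: power_mult_distrib mult.assoc)
  also have "real N / real M * ((real N + 1) / real N) = real (Suc N) / real M" using N by simp
  finally show ?case .
qed

text \<open>Pascal's rule writes a mass as a combination of two masses for \<open>N - 1\<close>
  trials, with weights at most \<open>max q (1 - q)\<close>; those two masses sum to at most
  1.\<close>

lemma binomial_peak_le_max: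
  fixes N :: nat
  assumes N: "N > 0"
  shows "binomial_peak q N \<le> max q (1 - q)"
proof -
  obtain k where k: "k \<le> N" "binomial_mass q k N = binomial_peak q N" by (rule binomial_peak_attained)
  obtain M where M: "N = Suc M" using N by (cases N) auto
  show ?thesis
  proof (cases k)
    case 0
    have "binomial_peak q N = (1 - q) ^ N" using k 0 by (simp add: binomial_mass_def)
    also have "\<dots> \<le> (1 - q) ^ 1" using N q0 q1 by (intro power_decreasing) auto
    finally show ?thesis by simp
  next
    case (Suc j)
    have "binomial_peak q N = q * binomial_mass q j M + (1 - q) * binomial_mass q (Suc j) M"
      using k M Suc by (simp add: binomial_mass_Suc_Suc)
    also have "\<dots> \<le> max q (1 - q) * binomial_mass q j M + max q (1 - q) * binomial_mass q (Suc j) M"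
      by (intro add_mono mult_right_mono mass_nonneg) auto
    also have "\<dots> = max q (1 - q) * (\<Sum>k\<in>{j, Suc j}. binomial_mass q k M)" by (simp add: algebra_simps)
    also have "(\<Sum>k\<in>{j, Suc j}. binomial_mass q k M) = (\<Sum>k\<in>{j, Suc j} \<inter> {0..M}. binomial_mass q k M)"
      by (rule sum.mono_neutral_right) (auto simp: binomial_mass_def binomial_eq_0)
    also have "\<dots> \<le> (\<Sum>k = 0..M. binomial_mass q k M)"
      by (intro sum_mono2) (auto simp: mass_nonneg)
    also have "\<dots> = 1" by (rule sum_binomial_mass)
    finally show ?thesis using q0 q1 by (simp add: mult_left_mono)
  qed
qed

end

subsection \<open>Lower bounds for the totient\<close>

text \<open>The worst case is a run of consecutive integers from 2, where the product telescopes. In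
  the induction the maximum \<open>b\<close> is at least \<open>card A + 2\<close>.\<close>

lemma prod_one_minus_inverse_ge:
  fixes A :: "nat set"
  assumes "finite A" "\<And>a. a \<in> A \<Longrightarrow> 2 \<le> a"
  shows "1 / (real (card A) + 1) \<le> (\<Prod>a\<in>A. 1 - 1 / real a)"
  using assms
proof (induction A rule: finite_linorder_max_induct)
  case empty
  then show ?case by simp
next
  case (insert b A)
  have "A \<subseteq> {2..<b}" using insert by auto
  then have "card A \<le> b - 2" using card_mono[of "{2..<b}" A] by simp
  then have b: "real (card A) + 2 \<le> real b" using insert.prems[of b] by simp
  have "b \<notin> A" using insert by auto
  have "1 / (real (card (insert b A)) + 1) = (1 - 1 / (real (card A) + 2)) * (1 / (real (card A) + 1))"
    using insert.hyps \<open>b \<notin> A\<close> by (simp add: field_simps)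
  also have "\<dots> \<le> (1 - 1 / real b) * (\<Prod>a\<in>A. 1 - 1 / real a)"
  proof (rule mult_mono)
    show "1 - 1 / (real (card A) + 2) \<le> 1 - 1 / real b" using b by (simp add: frac_le)
    show "1 / (real (card A) + 1) \<le> (\<Prod>a\<in>A. 1 - 1 / real a)" using insert by simp
    show "0 \<le> 1 - 1 / real b" using b by (simp add: field_simps)
  qed simp
  also have "\<dots> = (\<Prod>a\<in>insert b A. 1 - 1 / real a)" using insert.hyps \<open>b \<notin> A\<close> by simp
  finally show ?case .
qed

lemma card_prime_factors_le_log:
  assumes "n > 0"
  shows "real (card (prime_factors n)) \<le> log 2 (real n)"
proof -
  have "2 ^ card (prime_factors n) = (\<Prod>p\<in>prime_factors n. 2 :: nat)" by simp
  also have "\<dots> \<le> (\<Prod>p\<in>prime_factors n. p ^ multiplicity p n)"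
  proof (rule prod_mono)
    fix p assume p: "p \<in> prime_factors n"
    then have "2 \<le> p" "0 < multiplicity p n"
      by (auto simp: prime_factors_multiplicity intro: prime_ge_2_nat)
    then have "2 \<le> p ^ multiplicity p n" using self_le_power[of p "multiplicity p n"] by linarith
    then show "(0 :: nat) \<le> 2 \<and> 2 \<le> p ^ multiplicity p n" by simp
  qed
  also have "\<dots> = n" using prime_factorization_nat[OF assms] by simp
  finally have "(2 :: real) ^ card (prime_factors n) \<le> real n" by (simp flip: of_nat_le_iff)
  then have "2 powr real (card (prime_factors n)) \<le> real n" by (simp add: powr_realpow)
  then show ?thesis using assms by (simp add: le_log_iff)
qed

text \<open>Euler's product over the prime factors is compared with consecutive integers; there are
  at most \<open>log 2 n\<close> such factors.\<close>

lemma totient_lower_bound: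
  assumes "n > 0"
  shows "real n \<le> (1 + log 2 (real n)) * real (totient n)"
proof -
  have c: "real (card (prime_factors n)) + 1 > 0" by simp
  have "real n * (1 / (real (card (prime_factors n)) + 1)) \<le> real (totient n)"
    unfolding totient_formula2
    by (intro mult_left_mono prod_one_minus_inverse_ge) (auto intro: prime_ge_2_nat)
  then have "real n \<le> real (totient n) * (real (card (prime_factors n)) + 1)"
    using c by (simp add: field_simps)
  also have "\<dots> \<le> real (totient n) * (1 + log 2 (real n))"
    using card_prime_factors_le_log[OF assms] by (intro mult_left_mono) auto
  finally show ?thesis by (simp add: mult.commute)
qed

text \<open>After the previous bound the quotient is dominated by a null sequence, and boundedness
  of that sequence gives one constant for all \<open>d\<close>.\<close>

lemma sqrt_log_le_totient:
  "\<exists>c :: real. c \<ge> 1 \<and> (\<forall>d>0. sqrt (real d) * (1 + ln (real d)) \<le> c * real (totient d))"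
proof -
  let ?h = "\<lambda>d :: nat. sqrt (real d) * (1 + ln (real d)) * (1 + log 2 (real d)) / real d"
  have "?h \<longlonglongrightarrow> 0" by real_asymp
  then have "Bseq ?h" by (intro convergent_imp_Bseq convergentI)
  then obtain c where c: "c > 0" "\<And>d. norm (?h d) \<le> c" by (auto elim: BseqE)
  have "sqrt (real d) * (1 + ln (real d)) \<le> max 1 c * real (totient d)" if d: "d > 0" for d
  proof -
    have "sqrt (real d) * (1 + ln (real d)) * (1 + log 2 (real d)) \<le> c * real d"
      using c(2)[of d] d by (simp add: field_simps abs_le_iff)
    also have "\<dots> \<le> c * ((1 + log 2 (real d)) * real (totient d))"
      using c(1) totient_lower_bound[OF d] by (intro mult_left_mono) auto
    finally have "(1 + log 2 (real d)) * (sqrt (real d) * (1 + ln (real d))) \<le>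
        (1 + log 2 (real d)) * (c * real (totient d))" by (simp only: mult_ac)
    moreover have "1 + log 2 (real d) > 0" using d by (simp add: add_pos_nonneg)
    ultimately have "sqrt (real d) * (1 + ln (real d)) \<le> c * real (totient d)" by simp
    also have "\<dots> \<le> max 1 c * real (totient d)" by (intro mult_right_mono) auto
    finally show ?thesis .
  qed
  then show ?thesis by (intro exI[of _ "max 1 c"]) simp
qed

section \<open>Divisors whose prime factors are all at least \<open>p\<close>\<close>

lemma totient_mult_le: "totient a * totient b \<le> totient (a * b)"
proof (cases "gcd a b = 0")
  case False
  have "totient a * totient b * gcd a b = totient (a * b) * totient (gcd a b)"
    by (rule totient_gcd[symmetric])
  also have "\<dots> \<le> totient (a * b) * gcd a b" by (intro mult_left_mono totient_le) simp
  finally show ?thesis using False by (metis gr0I mult_le_cancel2)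
qed simp

lemma composite_least_prime_bounds:
  fixes p d :: nat
  assumes p: "prime p" and least: "\<forall>r. prime r \<longrightarrow> r dvd d \<longrightarrow> p \<le> r"
    and d: "d > 1" "\<not> prime d"
  shows "p * p \<le> d" "(p - 1) * (p - 1) \<le> totient d"
proof -
  obtain r where r: "prime r" "r dvd d" using d prime_factor_nat[of d] by auto
  then obtain m where m: "d = r * m" by (auto elim: dvdE)
  have "m \<noteq> 1" using m r d by auto
  then obtain s where s: "prime s" "s dvd m" using prime_factor_nat[of m] by auto
  have m0: "m > 0" using m d by (auto intro: Nat.gr0I)
  have le: "p \<le> r" "p \<le> s" using least r s m by auto
  have "s \<le> m" using s m0 by (auto intro: dvd_imp_le)
  then show "p * p \<le> d" unfolding m using le by (intro mult_le_mono) auto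
  have "(p - 1) * (p - 1) \<le> (r - 1) * (s - 1)" using le by (intro mult_le_mono) auto
  also have "\<dots> = totient r * totient s" using r s by (simp add: totient_prime)
  also have "\<dots> \<le> totient r * totient m"
    using s m0 prime_gt_0_nat[OF r(1)] by (intro mult_le_mono totient_dvd_mono) auto
  also have "\<dots> \<le> totient d" unfolding m by (rule totient_mult_le)
  finally show "(p - 1) * (p - 1) \<le> totient d" .
qed

text \<open>A prime \<open>d\<close> exceeds \<open>p\<close>, by at least 2 if \<open>p\<close> is
  odd, since both are odd. For composite \<open>d\<close>, use \<open>(p - 1)^2 > p\<close> if
  \<open>p\<close> is odd, and \<open>d > 2\<close> if \<open>p = 2\<close>.\<close>

lemma totient_ge_least_prime:
  fixes p d :: nat
  assumes p: "prime p" and least: "\<forall>r. prime r \<longrightarrow> r dvd d \<longrightarrow> p \<le> r"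
    and d: "d > 1" "d \<noteq> p"
  shows "p < d" "p \<le> totient d" "p \<noteq> 2 \<Longrightarrow> p < totient d"
proof -
  have p2: "p \<ge> 2" using p by (rule prime_ge_2_nat)
  have "p < d \<and> p \<le> totient d \<and> (p \<noteq> 2 \<longrightarrow> p < totient d)"
  proof (cases "prime d")
    case True
    have "p \<le> d" using least[rule_format, OF True dvd_refl] .
    then have "p < d" using d(2) by simp
    moreover have "p + 1 < d" if "p \<noteq> 2"
    proof (rule ccontr)
      assume "\<not> p + 1 < d"
      then have "d = p + 1" using \<open>p < d\<close> by simp
      moreover have "odd p" "odd d" 
        using prime_odd_nat[of p] prime_odd_nat[of d] p True that p2 \<open>p < d\<close> by auto
      ultimately show False by simp
    qed
    ultimately show ?thesis using True by (auto simp: totient_prime)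
  next
    case False
    note bounds = composite_least_prime_bounds[OF p least d(1) False]
    have "p < p * p" using p2 by simp
    then have "p < d" using bounds(1) by linarith
    show ?thesis
    proof (cases "p = 2")
      case True
      then show ?thesis using \<open>p < d\<close> totient_gt_1[of d] by auto
    next
      case False
      then obtain k where k: "p = k + 3" using p2 by (metis add.commute le_Suc_ex le_antisym not_less_eq_eq numeral_2_eq_2 numeral_3_eq_3)
      have "p < (p - 1) * (p - 1)" unfolding k by (simp add: algebra_simps)
      then show ?thesis using bounds(2) \<open>p < d\<close> by linarith
    qed
  qed
  then show "p < d" "p \<le> totient d" "p \<noteq> 2 \<Longrightarrow> p < totient d" by auto
qed

text \<open>The claim rearranges to \<open>4 (p - 1) \<le> 3 totient d\<close>. For odd
  \<open>p\<close> the totient is at least \<open>(p - 1)^2\<close>, hence \<open>2 (p - 1)\<close>;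
  for \<open>p = 2\<close> it is at least 2.\<close>

lemma totient_le_four_diff:
  fixes p d :: nat
  assumes p: "prime p" and least: "\<forall>r. prime r \<longrightarrow> r dvd d \<longrightarrow> p \<le> r"
    and d: "d > 1" "\<not> prime d"
  shows "totient d \<le> 4 * (totient d - p + 1)"
proof -
  have p2: "p \<ge> 2" using p by (rule prime_ge_2_nat)
  have "d \<noteq> p" using p d by auto
  note ge = totient_ge_least_prime[OF p least d(1) \<open>d \<noteq> p\<close>]
  note bounds = composite_least_prime_bounds[OF p least d]
  have "4 * (p - 1) \<le> 3 * totient d"
  proof (cases "p = 2")
    case False
    then have "2 * (p - 1) \<le> (p - 1) * (p - 1)" using p2 by (intro mult_le_mono1) simp
    then show ?thesis using bounds(2) by linarith
  qed (use ge(2) in simp)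
  moreover obtain e where "totient d = p + e" using ge(2) le_Suc_ex by blast
  ultimately show ?thesis using p2 by simp
qed

text \<open>Controls the cost of passing from \<open>n / d\<close> to \<open>n / p\<close>. For
  prime \<open>d\<close>, \<open>ln x \<le> x - 1\<close> gives \<open>d - p\<close>, which is
  exactly the excess term. For composite \<open>d\<close>, \<open>p \<le> sqrt d\<close>, and the
  totient exceeds \<open>sqrt d * ln d\<close> up to a constant and is comparable to the
  excess.\<close>

lemma least_prime_log_ratio_bound:
  obtains c :: real where "c \<ge> 1"
    "\<And>p d. \<lbrakk>prime p; \<forall>r. prime r \<longrightarrow> r dvd d \<longrightarrow> p \<le> r; d > 1; d \<noteq> p\<rbrakk> \<Longrightarrow>
       real p * ln (real d / real p) \<le> c * real (totient d - p + 1)"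
proof -
  obtain c :: real where c': "c \<ge> 1 \<and> (\<forall>d>0. sqrt (real d) * (1 + ln (real d)) \<le> c * real (totient d))"
    using sqrt_log_le_totient ..
  then have c: "c \<ge> 1" "\<And>d. d > 0 \<Longrightarrow> sqrt (real d) * (1 + ln (real d)) \<le> c * real (totient d)"
    by (blast, blast)
  have "real p * ln (real d / real p) \<le> 4 * c * real (totient d - p + 1)"
    if p: "prime p" and least: "\<forall>r. prime r \<longrightarrow> r dvd d \<longrightarrow> p \<le> r" and d: "d > 1" "d \<noteq> p" for p d
  proof -
    have p2: "p \<ge> 2" using p by (rule prime_ge_2_nat)
    note ge = totient_ge_least_prime[OF p least d]
    show ?thesis
    proof (cases "prime d")
      case True
      have "real p * ln (real d / real p) \<le> real p * (real d / real p - 1)"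
        using p2 d by (intro mult_left_mono ln_le_minus_one) auto
      also have "\<dots> = real d - real p" using p2 by (simp add: field_simps)
      also have "\<dots> = real (totient d - p + 1)" using True ge(1) by (simp add: totient_prime of_nat_diff)
      also have "\<dots> \<le> 4 * c * real (totient d - p + 1)"
        using c(1) by (simp add: mult_le_cancel_right1)
      finally show ?thesis .
    next
      case False
      note bounds = composite_least_prime_bounds[OF p least d(1) False]
      have "(real p)\<^sup>2 \<le> real d" using bounds(1) by (simp add: power2_eq_square flip: of_nat_mult)
      then have "real p \<le> sqrt (real d)" by (rule real_le_rsqrt)
      moreover have "ln (real d / real p) \<le> 1 + ln (real d)"
      proof -
        have "0 \<le> ln (real p)" using p2 by simp
        moreover have "ln (real d / real p) = ln (real d) - ln (real p)" using p2 d by (simp add: ln_div)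
        ultimately show ?thesis by linarith
      qed
      moreover have "0 \<le> ln (real d / real p)" using ge(1) p2 by simp
      ultimately have "real p * ln (real d / real p) \<le> sqrt (real d) * (1 + ln (real d))"
        by (intro mult_mono) auto
      also have "\<dots> \<le> c * real (totient d)" using c(2)[of d] d by simp
      also have "\<dots> \<le> c * real (4 * (totient d - p + 1))"
        using c(1) totient_le_four_diff[OF p least d(1) False]
        by (intro mult_left_mono) (simp_all del: of_nat_mult of_nat_add)
      also have "\<dots> = 4 * c * real (totient d - p + 1)" by (simp only: of_nat_mult of_nat_numeral mult_ac)
      finally show ?thesis .
    qed
  qed
  then show thesis using that[of "4 * c"] c(1) by simp
qed

text \<open>Prime \<open>d\<close> of small excess lie in the window \<open>{p..p + b}\<close>.
  Composite ones have totient at most \<open>4 (b + 1)\<close>, which bounds \<open>d\<close> by a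
  constant independent of \<open>p\<close> and \<open>n\<close>.\<close>

lemma small_totient_excess_bound:
  fixes b :: nat
  obtains K :: nat where
    "\<And>p n. \<lbrakk>prime p; n > 0; \<forall>r. prime r \<longrightarrow> r dvd n \<longrightarrow> p \<le> r\<rbrakk> \<Longrightarrow>
       card {d. d dvd n \<and> d \<noteq> 1 \<and> d \<noteq> p \<and> totient d - p < b} \<le> K"
proof -
  obtain c :: real where c': "c \<ge> 1 \<and> (\<forall>d>0. sqrt (real d) * (1 + ln (real d)) \<le> c * real (totient d))"
    using sqrt_log_le_totient ..
  then have c: "c \<ge> 1" "\<And>d. d > 0 \<Longrightarrow> sqrt (real d) * (1 + ln (real d)) \<le> c * real (totient d)"
    by (blast, blast)
  define D where "D = nat \<lceil>(c * real (4 * (b + 1)))\<^sup>2\<rceil>"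
  have "card {d. d dvd n \<and> d \<noteq> 1 \<and> d \<noteq> p \<and> totient d - p < b} \<le> b + 2 + D"
    if p: "prime p" and n: "n > 0" and least: "\<forall>r. prime r \<longrightarrow> r dvd n \<longrightarrow> p \<le> r" for p n
  proof -
    have "{d. d dvd n \<and> d \<noteq> 1 \<and> d \<noteq> p \<and> totient d - p < b} \<subseteq> {p..p + b} \<union> {..D}"
    proof
      fix d assume "d \<in> {d. d dvd n \<and> d \<noteq> 1 \<and> d \<noteq> p \<and> totient d - p < b}"
      then have d: "d dvd n" "d \<noteq> 1" "d \<noteq> p" "totient d - p < b" by auto
      have d1: "d > 1" using d n by (metis One_nat_def Suc_lessI dvd_0_left_iff not_gr_zero)
      have least': "\<forall>r. prime r \<longrightarrow> r dvd d \<longrightarrow> p \<le> r" using least d(1) by (metis dvd_trans)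
      show "d \<in> {p..p + b} \<union> {..D}"
      proof (cases "prime d")
        case True
        then have "d - 1 - p < b" using d(4) by (simp add: totient_prime)
        then have "d \<le> p + b" by linarith
        then show ?thesis using totient_ge_least_prime(1)[OF p least' d1 d(3)] by simp
      next
        case False
        note totient_le_four_diff[OF p least' d1 False]
        also have "4 * (totient d - p + 1) \<le> 4 * (b + 1)" using d(4) by simp
        finally have "totient d \<le> 4 * (b + 1)" .
        then have "c * real (totient d) \<le> c * real (4 * (b + 1))"
          using c(1) by (intro mult_left_mono) auto
        moreover have "sqrt (real d) \<le> sqrt (real d) * (1 + ln (real d))"
          using d1 by (simp add: mult_le_cancel_left1)
        ultimately have "sqrt (real d) \<le> c * real (4 * (b + 1))" using c(2)[of d] d1 by linarith
        then have "(sqrt (real d))\<^sup>2 \<le> (c * real (4 * (b + 1)))\<^sup>2" by (intro power_mono) auto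
        then have "real d \<le> (c * real (4 * (b + 1)))\<^sup>2" by simp
        then have "d \<le> D" unfolding D_def by linarith
        then show ?thesis by simp
      qed
    qed
    then have "card {d. d dvd n \<and> d \<noteq> 1 \<and> d \<noteq> p \<and> totient d - p < b} \<le> card ({p..p + b} \<union> {..D})"
      by (intro card_mono) auto
    also have "\<dots> \<le> card {p..p + b} + card {..D}" by (rule card_Un_le)
    finally show ?thesis by simp
  qed
  with that show thesis by blast
qed

subsection \<open>The contribution of the other divisors\<close>

context
  fixes q :: real
  assumes q0: "0 < q" and q1: "q < 1"
begin

text \<open>Split off \<open>p\<close> of the \<open>totient d\<close> factors and replace
  \<open>n / d\<close> by \<open>n / p\<close> in them. The loss is
  \<open>exp (C p ln (d / p))\<close>, at most \<open>B ^ (totient d - p + 1)\<close>; all but one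
  \<open>B\<close> are absorbed by the remaining factors.\<close>

lemma binomial_peak_power_le:
  fixes p d n :: nat and c :: real
  defines "B \<equiv> exp (real (growth_exponent q) * c)"
  assumes d: "d dvd n" "0 < n" and p: "p dvd n" "0 < p" "p \<le> d" "p \<le> totient d"
    and c: "real p * ln (real d / real p) \<le> c * real (totient d - p + 1)"
  shows "binomial_peak q (n div d) ^ totient d \<le>
    B * (B * binomial_peak q (n div d)) ^ (totient d - p) * binomial_peak q (n div p) ^ p"
proof -
  let ?C = "growth_exponent q"
  define M where "M = n div d"
  define N where "N = n div p"
  define f where "f = totient d"
  have d0: "d > 0" using d by (auto intro: Nat.gr0I)
  have nM: "n = d * M" and nN: "n = p * N" using d p by (simp_all add: M_def N_def)
  have M0: "M > 0" and N0: "N > 0" using nM nN d by (auto intro: Nat.gr0I)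
  have MN: "M \<le> N" unfolding M_def N_def using p by (intro div_le_mono2) auto
  have ratio: "real N / real M = real d / real p"
  proof -
    have "real d * real M = real p * real N" using nM nN by (metis of_nat_mult)
    then show ?thesis using M0 p by (simp add: field_simps)
  qed
  have pkM: "0 < binomial_peak q M" and pkN: "0 < binomial_peak q N"
    using binomial_peak_pos[OF q0 q1] by auto
  have "binomial_peak q M ^ p \<le> ((real d / real p) ^ ?C * binomial_peak q N) ^ p"
    using binomial_peak_ratio_le[OF q0 q1 M0 MN] pkM unfolding ratio by (intro power_mono) auto
  also have "\<dots> = ((real d / real p) ^ ?C) ^ p * binomial_peak q N ^ p" by (rule power_mult_distrib)
  also have "((real d / real p) ^ ?C) ^ p = exp (real ?C * (real p * ln (real d / real p)))"
  proof -
    have "real d / real p > 0" using d0 p by simp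
    then have "((real d / real p) ^ ?C) ^ p = (exp (ln (real d / real p)) ^ ?C) ^ p" by simp
    also have "\<dots> = exp (real ?C * (real p * ln (real d / real p)))"
      unfolding power_mult[symmetric] exp_of_nat_mult[symmetric] by (simp add: mult_ac)
    finally show ?thesis .
  qed
  also have "\<dots> \<le> exp (real ?C * (c * real (f - p + 1)))"
    using c unfolding f_def exp_le_cancel_iff by (intro mult_left_mono) auto
  also have "\<dots> = B ^ (f - p + 1)"
    unfolding B_def exp_of_nat_mult[symmetric] by (simp only: mult_ac)
  finally have "binomial_peak q M ^ p \<le> B ^ (f - p + 1) * binomial_peak q N ^ p"
    using pkN by (simp add: mult_right_mono)
  then have le: "binomial_peak q M ^ (f - p) * binomial_peak q M ^ p \<le>
      binomial_peak q M ^ (f - p) * (B ^ (f - p + 1) * binomial_peak q N ^ p)"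
    using pkM by (intro mult_left_mono) auto
  have eq1: "binomial_peak q M ^ (f - p) * binomial_peak q M ^ p = binomial_peak q M ^ f"
    using p(4) by (simp add: f_def flip: power_add)
  have eq2: "binomial_peak q M ^ (f - p) * (B ^ (f - p + 1) * binomial_peak q N ^ p) =
      B * (B * binomial_peak q M) ^ (f - p) * binomial_peak q N ^ p"
    by (simp only: power_mult_distrib power_add power_one_right mult_ac)
  show ?thesis using le unfolding eq1 eq2 unfolding M_def N_def f_def .
qed

lemma binomial_peak_small_divisor:
  fixes d n :: nat
  assumes d: "d dvd n" "0 < n" and small: "real d \<le> real n powr (3 / 4)"
  shows "binomial_peak q (n div d) \<le> 4 / sqrt (q * (1 - q)) * real n powr (- 1 / 8)"
proof -
  define M where "M = n div d"
  have nM: "n = d * M" using d by (simp add: M_def)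
  have d0: "d > 0" and M0: "M > 0" using nM d by (auto intro: Nat.gr0I)
  have "real n powr (3 / 4) * real n powr (1 / 4) = real d * real M"
    using d nM by (simp flip: powr_add of_nat_mult)
  also have "\<dots> \<le> real n powr (3 / 4) * real M" using small by (intro mult_right_mono) auto
  finally have "real n powr (1 / 4) \<le> real M" using d by simp
  then have "sqrt (real n powr (1 / 4)) \<le> sqrt (real M)" by simp
  also have "sqrt (real n powr (1 / 4)) = real n powr (1 / 8)"
    using d by (simp add: powr_half_sqrt[symmetric] powr_powr)
  finally have "1 / sqrt (real M) \<le> 1 / real n powr (1 / 8)"
    using d M0 by (intro divide_left_mono mult_pos_pos) simp_all
  also have "\<dots> = real n powr (- 1 / 8)" using powr_minus_divide[of "real n" "1 / 8"] by simp
  finally have *: "1 / sqrt (real M) \<le> real n powr (- 1 / 8)" .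
  have "binomial_peak q M \<le> 4 / sqrt (q * (1 - q)) * (1 / sqrt (real M))"
    using binomial_peak_le_inverse_sqrt[OF q0 q1 M0] by simp
  also have "\<dots> \<le> 4 / sqrt (q * (1 - q)) * real n powr (- 1 / 8)"
    using * q0 q1 by (intro mult_left_mono) auto
  finally show ?thesis by (simp add: M_def)
qed

text \<open>The left side is at most \<open>\<rho> ^ totient d\<close>, where the totient is nearly
  \<open>n^(3/4)\<close>. The peak at \<open>n / p\<close> is at least \<open>1 / n\<close>, so its
  \<open>p\<close>-th power loses at most \<open>n powr sqrt n\<close>, a much weaker
  effect.\<close>

lemma binomial_peak_large_divisor:
  fixes p d n :: nat
  assumes d: "d dvd n" and large: "real n powr (3 / 4) < real d"
    and n: "2 \<le> n" and p: "2 \<le> p" "p dvd n" "p * p \<le> n"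
  shows "binomial_peak q (n div d) ^ totient d \<le>
    real n powr sqrt (real n) * max q (1 - q) powr (real n powr (3 / 4) / (1 + log 2 (real n))) *
      binomial_peak q (n div p) ^ p"
proof -
  define \<rho> where "\<rho> = max q (1 - q)"
  have \<rho>: "0 < \<rho>" "\<rho> < 1" using q0 q1 by (auto simp: \<rho>_def)
  have d0: "d > 0" and dn: "d \<le> n" using d n by (auto intro: Nat.gr0I dvd_imp_le)
  have M0: "n div d > 0" using d0 dn by (simp add: div_greater_zero_iff)
  have L: "0 < 1 + log 2 (real d)" "1 + log 2 (real d) \<le> 1 + log 2 (real n)"
    using d0 dn by (simp_all add: add_pos_nonneg)
  have "real n powr (3 / 4) \<le> (1 + log 2 (real d)) * real (totient d)"
    using totient_lower_bound[OF d0] large by linarith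
  also have "\<dots> \<le> (1 + log 2 (real n)) * real (totient d)" using L by (intro mult_right_mono) auto
  finally have e: "real n powr (3 / 4) / (1 + log 2 (real n)) \<le> real (totient d)"
    using L by (simp add: field_simps)
  have "binomial_peak q (n div d) ^ totient d \<le> \<rho> ^ totient d"
    unfolding \<rho>_def using binomial_peak_le_max[OF q0 q1 M0] binomial_peak_pos[OF q0 q1, of "n div d"]
    by (intro power_mono) auto
  also have "\<dots> = \<rho> powr real (totient d)" using \<rho> by (simp add: powr_realpow)
  also have "\<dots> \<le> \<rho> powr (real n powr (3 / 4) / (1 + log 2 (real n)))"
    using \<rho> e by (intro powr_mono') auto
  finally have T: "binomial_peak q (n div d) ^ totient d \<le>
      \<rho> powr (real n powr (3 / 4) / (1 + log 2 (real n)))" .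
  have "1 \<le> real n powr sqrt (real n) * binomial_peak q (n div p) ^ p"
  proof -
    obtain N where N: "n = p * N" using p(2) by (auto elim: dvdE)
    have "N > 0" using N n by (auto intro: Nat.gr0I)
    have "n div p = N" using N p(1) by simp
    have "2 * N \<le> n" unfolding N using p(1) by (intro mult_le_mono1)
    then have "N + 1 \<le> n" using \<open>N > 0\<close> by linarith
    then have "1 / real n \<le> 1 / (real N + 1)" using n by (intro divide_left_mono) auto
    also have "\<dots> \<le> binomial_peak q N" by (rule binomial_peak_ge[OF q0 q1])
    finally have "1 \<le> real n * binomial_peak q N" using n by (simp add: field_simps)
    then have "1 \<le> (real n * binomial_peak q N) ^ p" by (rule one_le_power)
    also have "\<dots> = real n powr real p * binomial_peak q N ^ p"
      using n by (simp add: power_mult_distrib powr_realpow)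
    also have "\<dots> \<le> real n powr sqrt (real n) * binomial_peak q N ^ p"
    proof (intro mult_right_mono powr_mono)
      have "(real p)\<^sup>2 \<le> real n" using p(3) by (simp add: power2_eq_square flip: of_nat_mult)
      then show "real p \<le> sqrt (real n)" by (rule real_le_rsqrt)
    qed (use n binomial_peak_pos[OF q0 q1, of N] in auto)
    finally show ?thesis using \<open>n div p = N\<close> by simp
  qed
  then have "1 * \<rho> powr (real n powr (3 / 4) / (1 + log 2 (real n))) \<le>
      real n powr sqrt (real n) * binomial_peak q (n div p) ^ p *
        \<rho> powr (real n powr (3 / 4) / (1 + log 2 (real n)))"
    by (intro mult_right_mono) auto
  with T show ?thesis unfolding \<rho>_def by (simp add: mult_ac)
qed

lemma other_divisors_negligible:
  "\<exists>E. E \<longlonglongrightarrow> 0 \<and> (\<forall>\<^sub>F n in sequentially.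
    (\<Sum>d | d dvd n \<and> d \<noteq> 1 \<and> d \<noteq> smallest_prime_divisor n. binomial_peak q (n div d) ^ totient d) \<le>
    E n * (\<Sum>k = 0..n div smallest_prime_divisor n.
      binomial_mass q k (n div smallest_prime_divisor n) ^ smallest_prime_divisor n))"
proof -
  obtain c :: real where c1: "c \<ge> 1" and c:
    "\<And>p d. \<lbrakk>prime p; \<forall>r. prime r \<longrightarrow> r dvd d \<longrightarrow> p \<le> r; d > 1; d \<noteq> p\<rbrakk> \<Longrightarrow>
       real p * ln (real d / real p) \<le> c * real (totient d - p + 1)"
    by (rule least_prime_log_ratio_bound) auto
  \<comment> \<open>The threshold 17 works because each extra factor is of order
    \<open>n^(-1/8)\<close>: 17 of them outweigh the up to \<open>n\<close> divisors.\<close>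
  obtain K0 :: nat where K0:
    "\<And>p n. \<lbrakk>prime p; n > 0; \<forall>r. prime r \<longrightarrow> r dvd n \<longrightarrow> p \<le> r\<rbrakk> \<Longrightarrow>
       card {d. d dvd n \<and> d \<noteq> 1 \<and> d \<noteq> p \<and> totient d - p < 17} \<le> K0"
    by (rule small_totient_excess_bound[of 17]) auto
  define B where "B = exp (real (growth_exponent q) * c)"
  define K where "K = 4 / sqrt (q * (1 - q))"
  define \<rho> where "\<rho> = max q (1 - q)"
  \<comment> \<open>For \<open>p = 2\<close> one has \<open>N = n / 2\<close>, and
    \<open>sqrt A / 2 * (m / 2)^2\<close> with \<open>A = N q (1 - q)\<close> equals
    \<open>c3 * sqrt n * m^2\<close>.\<close>
  define c3 where "c3 = sqrt (q * (1 - q) / 2) / 8"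
  define x where "x = (\<lambda>n :: nat. B * (K * real n powr (- 1 / 8)))"
  define y where "y = (\<lambda>n :: nat. real n powr sqrt (real n) *
    \<rho> powr (real n powr (3 / 4) / (1 + log 2 (real n))))"
  define E where "E = (\<lambda>n. real K0 * B * (x n + 1 / (c3 * sqrt (real n))) + real n * (B * x n ^ 17 + y n))"
  have B: "B > 0" by (simp add: B_def)
  have K: "K > 0" using q0 q1 by (simp add: K_def)
  have c3: "c3 > 0" using q0 q1 by (simp add: c3_def)
  have \<rho>: "0 < \<rho>" "\<rho> < 1" using q0 q1 by (auto simp: \<rho>_def)
  have x_lim: "x \<longlonglongrightarrow> 0" unfolding x_def by real_asymp
  have x0: "x n \<ge> 0" for n unfolding x_def using B K by simp
  have y0: "y n \<ge> 0" for n unfolding y_def by simp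
  have E_lim: "E \<longlonglongrightarrow> 0"
  proof -
    have 1: "(\<lambda>n. 1 / (c3 * sqrt (real n))) \<longlonglongrightarrow> 0" using c3 by real_asymp
    have 2: "(\<lambda>n. real n * x n ^ 17) \<longlonglongrightarrow> 0"
      unfolding x_def using B K by real_asymp
    have 3: "(\<lambda>n. real n * y n) \<longlonglongrightarrow> 0"
    proof -
      \<comment> \<open>Writing the power of \<open>\<rho>\<close> as an exponential with rate
        \<open>-l\<close> makes the sign of the exponent explicit.\<close>
      define l where "l = - ln \<rho>"
      have "l > 0" using \<rho> by (simp add: l_def)
      then have "(\<lambda>n. real n * (real n powr sqrt (real n) *
        exp (- l * (real n powr (3 / 4) / (1 + log 2 (real n)))))) \<longlonglongrightarrow> 0"
        by real_asymp
      then show ?thesis unfolding y_def l_def using \<rho> by (simp add: powr_def mult_ac)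
    qed
    have "(\<lambda>n. real K0 * B * (x n + 1 / (c3 * sqrt (real n))) + (B * (real n * x n ^ 17) + real n * y n))
        \<longlonglongrightarrow> real K0 * B * (0 + 0) + (B * 0 + 0)"
      by (intro tendsto_intros x_lim 1 2 3)
    then show ?thesis unfolding E_def by (simp add: algebra_simps)
  qed
  have "\<forall>\<^sub>F n in sequentially. x n \<le> 1"
    using order_tendstoD(2)[OF x_lim, of 1] by (auto elim: eventually_mono)
  then have "\<forall>\<^sub>F n in sequentially.
    (\<Sum>d | d dvd n \<and> d \<noteq> 1 \<and> d \<noteq> smallest_prime_divisor n. binomial_peak q (n div d) ^ totient d) \<le>
    E n * (\<Sum>k = 0..n div smallest_prime_divisor n.
      binomial_mass q k (n div smallest_prime_divisor n) ^ smallest_prime_divisor n)"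
    using eventually_ge_at_top[of 2]
  proof eventually_elim
    case (elim n)
    note x1 = elim(1) and n = elim(2)
    define p where "p = smallest_prime_divisor n"
    define N where "N = n div p"
    define P where "P = binomial_peak q N ^ p"
    define S where "S = (\<Sum>k = 0..N. binomial_mass q k N ^ p)"
    define D where "D = {d. d dvd n \<and> d \<noteq> 1 \<and> d \<noteq> p}"
    \<comment> \<open>For odd \<open>p\<close> the excess is at least 1 and supplies a factor
      \<open>x n\<close>. For \<open>p = 2\<close> it may be 0, and the saving comes from
      \<open>S\<close> being larger than \<open>P\<close> by a factor of order
      \<open>sqrt n\<close>.\<close>
    define g where "g = (if p = 2 then 1 else x n)"
    have p: "prime p" "p dvd n" using prime_smallest_prime_divisor[OF n] by (simp_all add: p_def)
    have least: "\<forall>r. prime r \<longrightarrow> r dvd n \<longrightarrow> p \<le> r"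
      using prime_smallest_prime_divisor(3)[OF n] by (auto simp: p_def)
    have p2: "p \<ge> 2" using p(1) by (rule prime_ge_2_nat)
    have nN: "n = p * N" using p by (simp add: N_def)
    have N0: "N > 0" using nN n by (auto intro: Nat.gr0I)
    have P0: "P > 0" unfolding P_def using binomial_peak_pos[OF q0 q1] by simp
    have PS: "P \<le> S" unfolding P_def S_def by (rule binomial_peak_power_le_sum[OF q0 q1])
    have g0: "g \<ge> 0" using x0 by (simp add: g_def)
    have finD: "finite D" unfolding D_def using n by simp
    have D: "d dvd n" "d > 1" "d \<noteq> p" "\<forall>r. prime r \<longrightarrow> r dvd d \<longrightarrow> p \<le> r" if "d \<in> D" for d
    proof -
      show "d dvd n" "d \<noteq> p" using that by (auto simp: D_def)
      then have "d \<noteq> 0" using n by (metis dvd_0_left_iff not_numeral_le_zero)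
      then show "d > 1" using that by (auto simp: D_def)
      show "\<forall>r. prime r \<longrightarrow> r dvd d \<longrightarrow> p \<le> r" using least \<open>d dvd n\<close> by (metis dvd_trans)
    qed
    have bound: "binomial_peak q (n div d) ^ totient d \<le>
        (if totient d - p < 17 then B * g * P else 0) + (B * x n ^ 17 + y n) * P" if d: "d \<in> D" for d
    proof (cases "real d \<le> real n powr (3 / 4)")
      case True
      note ge = totient_ge_least_prime[OF p(1) D(4)[OF d] D(2)[OF d] D(3)[OF d]]
      have xd: "B * binomial_peak q (n div d) \<le> x n"
        unfolding x_def K_def using B binomial_peak_small_divisor[OF D(1)[OF d] _ True] n
        by (intro mult_left_mono) auto
      have "binomial_peak q (n div d) ^ totient d \<le>
          B * (B * binomial_peak q (n div d)) ^ (totient d - p) * P"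
        unfolding B_def P_def N_def
        by (rule binomial_peak_power_le) (use d D p p2 n ge c[OF p(1) D(4)[OF d] D(2)[OF d] D(3)[OF d]] in auto)
      also have "\<dots> \<le> B * x n ^ (totient d - p) * P"
        using xd B P0 binomial_peak_pos[OF q0 q1, of "n div d"]
        by (intro mult_right_mono mult_left_mono power_mono) auto
      also have "\<dots> \<le> (if totient d - p < 17 then B * g * P else 0) + (B * x n ^ 17 + y n) * P"
      proof (cases "totient d - p < 17")
        case True
        have "x n ^ (totient d - p) \<le> g"
        proof (cases "p = 2")
          case True
          then show ?thesis using x0 x1 by (simp add: g_def power_le_one)
        next
          case False
          then have "1 \<le> totient d - p" using ge(3) by simp
          then have "x n ^ (totient d - p) \<le> x n ^ 1" using x0 x1 by (intro power_decreasing) auto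
          then show ?thesis using False by (simp add: g_def)
        qed
        then have "B * x n ^ (totient d - p) * P \<le> B * g * P"
          using B P0 by (intro mult_right_mono mult_left_mono) auto
        moreover have "0 \<le> (B * x n ^ 17 + y n) * P" using B P0 x0 y0 by simp
        ultimately show ?thesis using True by simp
      next
        case False
        then have "x n ^ (totient d - p) \<le> x n ^ 17" using x0 x1 by (intro power_decreasing) auto
        then have "B * x n ^ (totient d - p) \<le> B * x n ^ 17" using B by (intro mult_left_mono) auto
        then have "B * x n ^ (totient d - p) \<le> B * x n ^ 17 + y n" using y0[of n] by linarith
        then show ?thesis using False P0 by (simp add: mult_right_mono)
      qed
      finally show ?thesis .
    next
      case False
      \<comment> \<open>A prime \<open>n\<close> would equal \<open>p\<close> and have no divisor in
        \<open>D\<close>.\<close>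
      have "\<not> prime n"
      proof
        assume "prime n"
        then have "p = n" "d = n" using p D[OF d] by (auto simp: prime_nat_iff)
        with D[OF d] show False by simp
      qed
      then have "p * p \<le> n" using composite_least_prime_bounds(1)[OF p(1) least] n by simp
      then have "binomial_peak q (n div d) ^ totient d \<le> y n * P"
        unfolding y_def \<rho>_def P_def N_def
        using False D(1)[OF d] n p p2 by (intro binomial_peak_large_divisor) auto
      also have "\<dots> \<le> (B * x n ^ 17 + y n) * P" using B P0 x0 by (intro mult_right_mono) auto
      also have "\<dots> \<le> (if totient d - p < 17 then B * g * P else 0) + (B * x n ^ 17 + y n) * P"
        using B P0 g0 by simp
      finally show ?thesis .
    qed
    have gS: "g * P \<le> (x n + 1 / (c3 * sqrt (real n))) * S"
    proof (cases "p = 2")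
      case True
      have "sqrt (real N * q * (1 - q)) / 2 * (binomial_peak q N / 2) ^ 2 \<le> S"
        using sum_binomial_mass_power_ge[OF q0 q1 N0, of 2] True by (simp add: S_def)
      moreover have "sqrt (real N * q * (1 - q)) = sqrt (real n) * sqrt (q * (1 - q) / 2)"
        unfolding nN True by (simp add: real_sqrt_mult[symmetric])
      ultimately have "c3 * sqrt (real n) * P \<le> S"
        unfolding c3_def P_def True by (simp add: power_divide mult_ac)
      moreover have "c3 * sqrt (real n) > 0" using c3 n by simp
      ultimately have "P \<le> 1 / (c3 * sqrt (real n)) * S" by (simp add: field_simps)
      also have "\<dots> \<le> (x n + 1 / (c3 * sqrt (real n))) * S"
        using x0[of n] P0 PS by (intro mult_right_mono) auto
      finally show ?thesis using True by (simp add: g_def)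
    next
      case False
      have "x n * P \<le> x n * S" using x0 PS by (intro mult_left_mono)
      also have "\<dots> \<le> (x n + 1 / (c3 * sqrt (real n))) * S"
        using c3 P0 PS by (intro mult_right_mono) auto
      finally show ?thesis using False by (simp add: g_def)
    qed
    have "(\<Sum>d\<in>D. binomial_peak q (n div d) ^ totient d) \<le>
        (\<Sum>d\<in>D. (if totient d - p < 17 then B * g * P else 0) + (B * x n ^ 17 + y n) * P)"
      by (intro sum_mono bound)
    also have "\<dots> = (\<Sum>d\<in>D. if totient d - p < 17 then B * g * P else 0) +
        real (card D) * ((B * x n ^ 17 + y n) * P)"
      by (simp add: sum.distrib)
    also have "(\<Sum>d\<in>D. if totient d - p < 17 then B * g * P else 0) =
        real (card {d\<in>D. totient d - p < 17}) * (B * g * P)"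
      using finD by (simp add: sum.inter_filter[symmetric])
    also have "\<dots> \<le> real K0 * (B * g * P)"
      using K0[OF p(1) _ least] n B g0 P0 by (intro mult_right_mono) (auto simp: D_def conj_assoc)
    also have "\<dots> = real K0 * B * (g * P)" by simp
    also have "\<dots> \<le> real K0 * B * ((x n + 1 / (c3 * sqrt (real n))) * S)"
      using gS B by (intro mult_left_mono) auto
    also have "real (card D) * ((B * x n ^ 17 + y n) * P) \<le> real n * ((B * x n ^ 17 + y n) * S)"
    proof (intro mult_mono)
      have "D \<subseteq> {1..n}"
      proof
        fix d assume d: "d \<in> D"
        have "d \<le> n" using D(1)[OF d] n by (intro dvd_imp_le) auto
        then show "d \<in> {1..n}" using D(2)[OF d] by simp
      qed
      then have "card D \<le> card {1..n}" by (intro card_mono) auto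
      then show "real (card D) \<le> real n" by simp
    qed (use B P0 PS x0 y0 in auto)
    finally have "(\<Sum>d\<in>D. binomial_peak q (n div d) ^ totient d) \<le> E n * S"
      unfolding E_def by (simp add: algebra_simps)
    then show ?case unfolding D_def S_def N_def p_def .
  qed
  with E_lim show ?thesis by blast
qed

end

section \<open>Asymptotic equivalence\<close>

theorem theorem1p1:
  fixes q :: real
  assumes "0 < q" and "q < 1"
  shows "(\<lambda>n. prob_singular_circulant q n) \<sim>[at_top]
    (\<lambda>n. \<Sum>k = 0..n div smallest_prime_divisor n.
           binomial_mass q k (n div smallest_prime_divisor n) ^ smallest_prime_divisor n)"
proof -
  define S where "S = (\<lambda>n. \<Sum>k = 0..n div smallest_prime_divisor n.
    binomial_mass q k (n div smallest_prime_divisor n) ^ smallest_prime_divisor n)"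
  define T where "T = (\<lambda>n. \<Sum>d | d dvd n \<and> d \<noteq> 1 \<and> d \<noteq> smallest_prime_divisor n.
    binomial_peak q (n div d) ^ totient d)"
  obtain E where E: "E \<longlonglongrightarrow> 0" "\<forall>\<^sub>F n in sequentially. T n \<le> E n * S n"
    using other_divisors_negligible[OF assms] unfolding S_def T_def by blast
  have S0: "S n > 0" for n
    using binomial_peak_power_le_sum[OF assms] binomial_peak_pos[OF assms]
    unfolding S_def by (metis less_le_trans zero_less_power)
  have bounds: "S n \<le> prob_singular_circulant q n" "prob_singular_circulant q n \<le> S n + T n"
    if "n \<ge> 2" for n
    using prob_singular_circulant_bounds[of q n "smallest_prime_divisor n"]
      prime_smallest_prime_divisor(1,2)[OF that] assms that
    unfolding S_def T_def by auto
  \<comment> \<open>From \<open>S \<le> P \<le> S + T\<close> and \<open>T \<le> E S\<close>, where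
    \<open>P\<close> is the singularity probability, the ratio lies between 1 and
    \<open>1 + E n\<close>.\<close>
  have "(\<lambda>n. prob_singular_circulant q n / S n) \<longlonglongrightarrow> 1"
  proof (rule tendsto_sandwich)
    show "\<forall>\<^sub>F n in sequentially. 1 \<le> prob_singular_circulant q n / S n"
      using eventually_ge_at_top[of 2] by eventually_elim (use bounds(1) S0 in simp)
    show "\<forall>\<^sub>F n in sequentially. prob_singular_circulant q n / S n \<le> 1 + E n"
      using eventually_ge_at_top[of 2] E(2)
    proof eventually_elim
      case (elim n)
      have "prob_singular_circulant q n \<le> S n + E n * S n" using bounds(2)[OF elim(1)] elim(2) by linarith
      then show ?case using S0[of n] by (simp add: field_simps)
    qed
    show "(\<lambda>n. 1 + E n) \<longlonglongrightarrow> 1" using tendsto_add[OF tendsto_const E(1), of 1] by simp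
  qed simp
  then show ?thesis unfolding S_def by (rule asymp_equivI')
qed

end
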